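(* Let $\mathcal M=(M,d,(q_i)_{i\in\mathbb N})$ be a computable metric space that is perfect (has no isolated points). Then for every special point $p$ and every rational $\delta>0$ there is a noncomputable $K$-trivial point $x\in M$ with $d(p,x)<\delta$.
   Context: A computable metric space is a complete separable metric space $(M,d)$ with a dense sequence $(q_i)$ without repetitions (the special points, identified with their indices $i\in\mathbb N$) such that $d(q_i,q_k)$ is a computable real uniformly in $i,k$. A Cauchy name is a function $\alpha:\mathbb N\to\mathbb N$ with $d(q_{\alpha(s)},q_{\alpha(t)})\le 2^{-s}$ for all $t\ge s$; it names $\lim_s q_{\alpha(s)}$. A point is computable if it has a computable Cauchy name. With $K$ prefix-free complexity (applied to tuples via a fixed effective encoding), a function $\alpha:\mathbb N\to\mathbb N$ is $K$-trivial if there is $b$ with $K(\alpha\upharpoonright n)\le K(0^n)+b$ for all $n$; a point is $K$-trivial if it has a $K$-trivial Cauchy name. *)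

theory Defs
  imports "HOL-Analysis.Analysis" "HOL-Library.Extended_Nat"
begin

datatype recf = Zero | Succ | Proj nat | Comp recf "recf list" | Prim recf recf | Mn recf

inductive reval :: "recf \<Rightarrow> nat list \<Rightarrow> nat \<Rightarrow> bool" where
  zero: "reval Zero xs 0"
| succ: "reval Succ (x # xs) (Suc x)"
| proj: "i < length xs \<Longrightarrow> reval (Proj i) xs (xs ! i)"
| comp: "list_all2 (\<lambda>g y. reval g xs y) gs ys \<Longrightarrow> reval f ys z \<Longrightarrow> reval (Comp f gs) xs z"
| prim0: "reval f xs y \<Longrightarrow> reval (Prim f g) (0 # xs) y"
| primS: "reval (Prim f g) (n # xs) y \<Longrightarrow> reval g (y # n # xs) z \<Longrightarrow> reval (Prim f g) (Suc n # xs) z"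
| mn: "reval f (n # xs) 0 \<Longrightarrow> (\<forall>m<n. \<exists>y. reval f (m # xs) (Suc y)) \<Longrightarrow> reval (Mn f) xs n"

definition partial_computable :: "(nat \<Rightarrow> nat option) \<Rightarrow> bool" where
  "partial_computable f \<longleftrightarrow> (\<exists>t. \<forall>x y. reval t [x] y \<longleftrightarrow> f x = Some y)"

definition computable_fun :: "(nat \<Rightarrow> nat) \<Rightarrow> bool" where
  "computable_fun f \<longleftrightarrow> partial_computable (\<lambda>x. Some (f x))"

definition computable_fun3 :: "(nat \<Rightarrow> nat \<Rightarrow> nat \<Rightarrow> nat) \<Rightarrow> bool" where
  "computable_fun3 f \<longleftrightarrow> (\<exists>t. \<forall>i k n y. reval t [i, k, n] y \<longleftrightarrow> f i k n = y)"

fun nat_of_bl :: "bool list \<Rightarrow> nat" where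
  "nat_of_bl [] = 0"
| "nat_of_bl (b # bs) = 2 * nat_of_bl bs + (if b then 2 else 1)"

fun bl_of_nat :: "nat \<Rightarrow> bool list" where
  "bl_of_nat 0 = []"
| "bl_of_nat (Suc m) = odd m # bl_of_nat (m div 2)"

type_synonym machine = "bool list \<Rightarrow> bool list option"

definition computable_machine :: "machine \<Rightarrow> bool" where
  "computable_machine U \<longleftrightarrow>
     partial_computable (\<lambda>m. map_option nat_of_bl (U (bl_of_nat m)))"

definition prefix_free_machine :: "machine \<Rightarrow> bool" where
  "prefix_free_machine U \<longleftrightarrow> computable_machine U \<and>
     (\<forall>p r. U p \<noteq> None \<longrightarrow> U (p @ r) \<noteq> None \<longrightarrow> r = [])"

definition Kc :: "machine \<Rightarrow> bool list \<Rightarrow> enat" where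
  "Kc U \<sigma> = (if \<exists>p. U p = Some \<sigma> then enat (LEAST n. \<exists>p. U p = Some \<sigma> \<and> length p = n) else \<infinity>)"

definition optimal_machine :: "machine \<Rightarrow> bool" where
  "optimal_machine U \<longleftrightarrow> prefix_free_machine U \<and>
     (\<forall>N. prefix_free_machine N \<longrightarrow> (\<exists>c::nat. \<forall>\<sigma>. Kc U \<sigma> \<le> Kc N \<sigma> + enat c))"

text \<open>Fixed effective encoding of tuples of naturals as binary strings (unary, self-delimiting).\<close>
definition enc_tuple :: "nat list \<Rightarrow> bool list" where
  "enc_tuple xs = concat (map (\<lambda>x. replicate x True @ [False]) xs)"

definition restr :: "(nat \<Rightarrow> nat) \<Rightarrow> nat \<Rightarrow> nat list" where
  "restr \<alpha> n = map \<alpha> [0..<n]"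

definition K_trivial_fun :: "(nat \<Rightarrow> nat) \<Rightarrow> bool" where
  "K_trivial_fun \<alpha> \<longleftrightarrow> (\<exists>U. optimal_machine U \<and>
     (\<exists>b::nat. \<forall>n. Kc U (enc_tuple (restr \<alpha> n)) \<le> Kc U (enc_tuple (replicate n 0)) + enat b))"

definition computable_metric_space :: "(nat \<Rightarrow> 'a::metric_space) \<Rightarrow> bool" where
  "computable_metric_space q \<longleftrightarrow>
     complete (UNIV :: 'a set) \<and> closure (range q) = UNIV \<and> inj q \<and>
     (\<exists>f. computable_fun3 f \<and>
        (\<forall>i k n. case prod_decode (f i k n) of (a, b) \<Rightarrow>
            \<bar>dist (q i) (q k) - (real a - real b) / 2 ^ n\<bar> \<le> 1 / 2 ^ n))"

definition cauchy_name :: "(nat \<Rightarrow> 'a::metric_space) \<Rightarrow> (nat \<Rightarrow> nat) \<Rightarrow> bool" where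
  "cauchy_name q \<alpha> \<longleftrightarrow> (\<forall>s t. s \<le> t \<longrightarrow> dist (q (\<alpha> s)) (q (\<alpha> t)) \<le> 1 / 2 ^ s)"

definition names :: "(nat \<Rightarrow> 'a::metric_space) \<Rightarrow> (nat \<Rightarrow> nat) \<Rightarrow> 'a \<Rightarrow> bool" where
  "names q \<alpha> x \<longleftrightarrow> cauchy_name q \<alpha> \<and> (\<lambda>s. q (\<alpha> s)) \<longlonglongrightarrow> x"

definition computable_point :: "(nat \<Rightarrow> 'a::metric_space) \<Rightarrow> 'a \<Rightarrow> bool" where
  "computable_point q x \<longleftrightarrow> (\<exists>\<alpha>. computable_fun \<alpha> \<and> names q \<alpha> x)"

definition K_trivial_point :: "(nat \<Rightarrow> 'a::metric_space) \<Rightarrow> 'a \<Rightarrow> bool" where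
  "K_trivial_point q x \<longleftrightarrow> (\<exists>\<alpha>. K_trivial_fun \<alpha> \<and> names q \<alpha> x)"

end

theory Submission
  imports Defs
begin

text \<open>In a perfect computable space one can search for splittings of balls and so obtain a
  computable Cantor scheme around \<open>p\<close>: a subset \<open>A\<close> of the naturals selects a branch, the special
  points along it form a Cauchy name of its limit whose restriction to \<open>n\<close> is computed from \<open>A\<close>
  restricted to \<open>n\<close>, and \<open>A\<close> can be recovered from every Cauchy name of the limit. It remains to
  take for \<open>A\<close> a noncomputable set of low cost. Row \<open>e\<close> of \<open>A\<close> gets an element \<open>x\<close> at the first
  stage \<open>s\<close> where the \<open>e\<close>-th program is seen to answer \<open>0\<close> on \<open>x\<close> and the descriptions of strings
  \<open>0\<^sup>n\<close>, \<open>n > x\<close>, that have appeared so far weigh at most \<open>2\<^sup>-\<^sup>e\<^sup>-\<^sup>1\<close> together. The total weight of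
  the descriptions of restrictions that have to be renewed when \<open>A\<close> changes is then bounded, and
  the Kraft-Chaitin theorem turns them into a machine.\<close>

section \<open>Closure properties of recursive functions\<close>

text \<open>The two demands on the point are asymmetric. K-triviality asks for one good name, so the
  branch itself will do; noncomputability concerns every name, so the sons of a ball must be
  separated by a margin that survives the error of an arbitrary name. Low cost and diagonalisation
  are compatible because all descriptions together have finite weight: the price of changing the set
  at \<open>x\<close> falls below any bound, uniformly in the stage, once \<open>x\<close> is large,
  and every row contains such \<open>x\<close>. One change per row keeps the total price at most the
  sum of all 2^-(e+1), which is 1. The obstacle is that K-triviality demands an optimal machine
  while evaluation is only given as an inductive relation. Evaluation is therefore made searchable
  by finite certificates, and the optimal machine is itself built from a request sequence. The same
  construction of machines thus serves twice, and the stages of the first sequence are what the cost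
  is measured by.\<close>

lemma reval_Zero_iff [simp]: "reval Zero xs y \<longleftrightarrow> y = 0"
  by (subst reval.simps) auto

lemma reval_Succ_iff [simp]: "reval Succ xs y \<longleftrightarrow> (\<exists>x zs. xs = x # zs \<and> y = Suc x)"
  by (subst reval.simps) auto

lemma reval_Proj_iff [simp]: "reval (Proj i) xs y \<longleftrightarrow> i < length xs \<and> y = xs ! i"
  by (subst reval.simps) auto

lemma reval_Comp_iff:
  "reval (Comp f gs) xs z \<longleftrightarrow> (\<exists>ys. list_all2 (\<lambda>g y. reval g xs y) gs ys \<and> reval f ys z)"
  by (subst reval.simps) auto

lemma reval_Prim_0_iff [simp]: "reval (Prim f g) (0 # xs) z \<longleftrightarrow> reval f xs z"
  by (subst reval.simps) auto

lemma reval_Prim_Suc_iff: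
  "reval (Prim f g) (Suc n # xs) z \<longleftrightarrow> (\<exists>y. reval (Prim f g) (n # xs) y \<and> reval g (y # n # xs) z)"
  by (subst reval.simps) auto

lemma reval_Mn_iff:
  "reval (Mn f) xs n \<longleftrightarrow> reval f (n # xs) 0 \<and> (\<forall>m<n. \<exists>y. reval f (m # xs) (Suc y))"
  by (subst reval.simps) auto

text \<open>The equivalence with a total \<open>F\<close> says at once that \<open>t\<close> halts
  on every list of length \<open>k\<close> and has a single value there, so determinism of
  \<open>reval\<close> needs no separate proof.\<close>

definition computes :: "nat \<Rightarrow> recf \<Rightarrow> (nat list \<Rightarrow> nat) \<Rightarrow> bool" where
  "computes k t F \<longleftrightarrow> (\<forall>xs y. length xs = k \<longrightarrow> (reval t xs y \<longleftrightarrow> F xs = y))"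

definition recursive :: "nat \<Rightarrow> (nat list \<Rightarrow> nat) \<Rightarrow> bool" where
  "recursive k F \<longleftrightarrow> (\<exists>t. computes k t F)"

lemma recursive_cong:
  assumes "recursive k F" "\<And>xs. length xs = k \<Longrightarrow> F xs = G xs"
  shows "recursive k G"
  using assms unfolding recursive_def computes_def by auto

lemma list_all2_computes:
  assumes "list_all2 (computes k) ts Gs" "length xs = k"
  shows "list_all2 (\<lambda>g y. reval g xs y) ts ys \<longleftrightarrow> ys = map (\<lambda>G. G xs) Gs"
  using assms
  by (auto simp: list_all2_conv_all_nth computes_def intro!: nth_equalityI)

lemma computes_Comp:
  assumes "computes (length Gs) t F" "list_all2 (computes k) ts Gs"
  shows "computes k (Comp t ts) (\<lambda>xs. F (map (\<lambda>G. G xs) Gs))"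
  using assms(1) unfolding computes_def[of k] computes_def[of "length Gs"]
  by (auto simp: reval_Comp_iff list_all2_computes[OF assms(2)])

lemma recursive_comp1:
  assumes "recursive 1 F" "recursive k G"
  shows "recursive k (\<lambda>xs. F [G xs])"
proof -
  obtain t u where "computes 1 t F" "computes k u G"
    using assms unfolding recursive_def by blast
  then have "computes k (Comp t [u]) (\<lambda>xs. F (map (\<lambda>G. G xs) [G]))"
    by (intro computes_Comp) auto
  then show ?thesis unfolding recursive_def by auto
qed

lemma recursive_comp2:
  assumes "recursive 2 F" "recursive k G" "recursive k H"
  shows "recursive k (\<lambda>xs. F [G xs, H xs])"
proof -
  obtain t u v where "computes 2 t F" "computes k u G" "computes k v H"
    using assms unfolding recursive_def by blast
  then have "computes k (Comp t [u, v]) (\<lambda>xs. F (map (\<lambda>G. G xs) [G, H]))"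
    by (intro computes_Comp) (auto simp: numeral_2_eq_2)
  then show ?thesis unfolding recursive_def by auto
qed

lemma recursive_comp3:
  assumes "recursive 3 F" "recursive k G" "recursive k H" "recursive k J"
  shows "recursive k (\<lambda>xs. F [G xs, H xs, J xs])"
proof -
  obtain t u v w where "computes 3 t F" "computes k u G" "computes k v H" "computes k w J"
    using assms unfolding recursive_def by blast
  then have "computes k (Comp t [u, v, w]) (\<lambda>xs. F (map (\<lambda>G. G xs) [G, H, J]))"
    by (intro computes_Comp) (auto simp: numeral_3_eq_3)
  then show ?thesis unfolding recursive_def by auto
qed

lemma recursive_proj: "i < k \<Longrightarrow> recursive k (\<lambda>xs. xs ! i)"
  unfolding recursive_def computes_def by (rule exI[of _ "Proj i"]) auto

lemma recursive_Suc0: "recursive 1 (\<lambda>xs. Suc (xs ! 0))"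
  unfolding recursive_def computes_def by (rule exI[of _ Succ]) (auto simp: length_Suc_conv)

lemma recursive_Suc: "recursive k F \<Longrightarrow> recursive k (\<lambda>xs. Suc (F xs))"
  using recursive_comp1[OF recursive_Suc0, of k F] by simp

lemma recursive_const: "recursive k (\<lambda>xs. c)"
proof (induction c)
  case 0
  show ?case unfolding recursive_def computes_def by (rule exI[of _ Zero]) auto
qed (rule recursive_Suc)

lemma recursive_prim:
  assumes "recursive k F" "recursive (Suc (Suc k)) G"
  shows "recursive (Suc k) (\<lambda>xs. rec_nat (F (tl xs)) (\<lambda>n y. G (y # n # tl xs)) (hd xs))"
proof -
  obtain t u where t: "computes k t F" and u: "computes (Suc (Suc k)) u G"
    using assms unfolding recursive_def by blast
  have "reval (Prim t u) (n # xs) y \<longleftrightarrow> rec_nat (F xs) (\<lambda>n y. G (y # n # xs)) n = y"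
    if "length xs = k" for n xs y
    using that t u unfolding computes_def
    by (induction n arbitrary: y) (auto simp: reval_Prim_Suc_iff)
  then have "computes (Suc k) (Prim t u)
      (\<lambda>xs. rec_nat (F (tl xs)) (\<lambda>n y. G (y # n # tl xs)) (hd xs))"
    unfolding computes_def by (auto simp: length_Suc_conv)
  then show ?thesis unfolding recursive_def by blast
qed

section \<open>Arithmetic by primitive recursion\<close>

lemma recursive_add0: "recursive 2 (\<lambda>xs. xs ! 0 + xs ! 1)"
proof -
  have "recursive (Suc 1) (\<lambda>xs. rec_nat ((\<lambda>xs. xs ! 0) (tl xs))
          (\<lambda>n y. (\<lambda>xs. Suc (xs ! 0)) (y # n # tl xs)) (hd xs))"
    by (intro recursive_prim recursive_proj recursive_Suc) auto
  then show ?thesis unfolding Suc_1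
  proof (rule recursive_cong)
    fix xs :: "nat list" assume "length xs = 2"
    then obtain a b where "xs = [a, b]" by (auto simp: eval_nat_numeral length_Suc_conv)
    moreover have "rec_nat b (\<lambda>n. Suc) a = a + b" by (induction a) auto
    ultimately show "rec_nat ((\<lambda>xs. xs ! 0) (tl xs))
          (\<lambda>n y. (\<lambda>xs. Suc (xs ! 0)) (y # n # tl xs)) (hd xs) = xs ! 0 + xs ! 1" by simp
  qed
qed

lemma recursive_add: "recursive k F \<Longrightarrow> recursive k G \<Longrightarrow> recursive k (\<lambda>xs. F xs + G xs)"
  using recursive_comp2[OF recursive_add0, of k F G] by simp

lemma recursive_pred0: "recursive 1 (\<lambda>xs. xs ! 0 - 1)"
proof -
  have "recursive (Suc 0) (\<lambda>xs. rec_nat ((\<lambda>xs. 0) (tl xs))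
          (\<lambda>n y. (\<lambda>xs. xs ! 1) (y # n # tl xs)) (hd xs))"
    by (intro recursive_prim recursive_proj recursive_const) auto
  then show ?thesis unfolding One_nat_def
  proof (rule recursive_cong)
    fix xs :: "nat list" assume "length xs = Suc 0"
    then obtain a where "xs = [a]" by (auto simp: length_Suc_conv)
    then show "rec_nat ((\<lambda>xs. 0) (tl xs))
          (\<lambda>n y. (\<lambda>xs. xs ! Suc 0) (y # n # tl xs)) (hd xs) = xs ! 0 - Suc 0"
      by (cases a) auto
  qed
qed

lemma recursive_pred: "recursive k F \<Longrightarrow> recursive k (\<lambda>xs. F xs - 1)"
  using recursive_comp1[OF recursive_pred0, of k F] by simp

text \<open>Primitive recursion runs on the head of the list, so the subtrahend has to come first;
  \<open>recursive_diff\<close> restores the usual order.\<close>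

lemma recursive_diff0: "recursive 2 (\<lambda>xs. xs ! 1 - xs ! 0)"
proof -
  have "recursive (Suc 1) (\<lambda>xs. rec_nat ((\<lambda>xs. xs ! 0) (tl xs))
          (\<lambda>n y. (\<lambda>xs. xs ! 0 - 1) (y # n # tl xs)) (hd xs))"
    by (intro recursive_prim recursive_proj recursive_pred) auto
  then show ?thesis unfolding Suc_1
  proof (rule recursive_cong)
    fix xs :: "nat list" assume "length xs = 2"
    then obtain a b where "xs = [a, b]" by (auto simp: eval_nat_numeral length_Suc_conv)
    moreover have "rec_nat b (\<lambda>n y. y - 1) a = b - a" by (induction a) auto
    ultimately show "rec_nat ((\<lambda>xs. xs ! 0) (tl xs))
          (\<lambda>n y. (\<lambda>xs. xs ! 0 - 1) (y # n # tl xs)) (hd xs) = xs ! 1 - xs ! 0" by simp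
  qed
qed

lemma recursive_diff: "recursive k F \<Longrightarrow> recursive k G \<Longrightarrow> recursive k (\<lambda>xs. F xs - G xs)"
  using recursive_comp2[OF recursive_diff0, of k G F] by simp

section \<open>The Cantor pairing function and its inverse\<close>

lemma recursive_triangle0: "recursive 1 (\<lambda>xs. triangle (xs ! 0))"
proof -
  have "recursive (Suc 0) (\<lambda>xs. rec_nat ((\<lambda>xs. 0) (tl xs))
          (\<lambda>n y. (\<lambda>xs. xs ! 0 + Suc (xs ! 1)) (y # n # tl xs)) (hd xs))"
    by (intro recursive_prim recursive_proj recursive_const recursive_add recursive_Suc) auto
  then show ?thesis unfolding One_nat_def
  proof (rule recursive_cong)
    fix xs :: "nat list" assume "length xs = Suc 0"
    then obtain a where "xs = [a]" by (auto simp: length_Suc_conv)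
    moreover have "rec_nat 0 (\<lambda>n y. y + Suc n) a = triangle a"
      by (induction a) auto
    ultimately show "rec_nat ((\<lambda>xs. 0) (tl xs))
          (\<lambda>n y. (\<lambda>xs. xs ! 0 + Suc (xs ! Suc 0)) (y # n # tl xs)) (hd xs) = triangle (xs ! 0)"
      by simp
  qed
qed

lemma recursive_triangle: "recursive k F \<Longrightarrow> recursive k (\<lambda>xs. triangle (F xs))"
  using recursive_comp1[OF recursive_triangle0, of k F] by simp

lemma recursive_prod_encode:
  "recursive k F \<Longrightarrow> recursive k G \<Longrightarrow> recursive k (\<lambda>xs. prod_encode (F xs, G xs))"
  unfolding prod_encode_def by (auto intro!: recursive_add recursive_triangle)

lemma recursive_Least:
  assumes "recursive (Suc k) F" "\<And>xs. length xs = k \<Longrightarrow> \<exists>n. F (n # xs) = 0"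
  shows "recursive k (\<lambda>xs. LEAST n. F (n # xs) = 0)"
proof -
  obtain t where t: "computes (Suc k) t F"
    using assms unfolding recursive_def by blast
  have "computes k (Mn t) (\<lambda>xs. LEAST n. F (n # xs) = 0)"
    unfolding computes_def
  proof (intro allI impI)
    fix xs :: "nat list" and y :: nat assume l: "length xs = k"
    have *: "reval t (n # xs) z \<longleftrightarrow> F (n # xs) = z" for n z
      using t l unfolding computes_def by auto
    have "reval (Mn t) xs y \<longleftrightarrow> F (y # xs) = 0 \<and> (\<forall>m<y. F (m # xs) \<noteq> 0)"
      by (auto simp: reval_Mn_iff * gr0_conv_Suc)
    also have "\<dots> \<longleftrightarrow> (LEAST n. F (n # xs) = 0) = y"
      using assms(2)[OF l] LeastI_ex[of "\<lambda>n. F (n # xs) = 0"] not_less_Least[of _ "\<lambda>n. F (n # xs) = 0"]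
      by (metis (mono_tags, lifting) linorder_neqE_nat)
    finally show "reval (Mn t) xs y \<longleftrightarrow> (LEAST n. F (n # xs) = 0) = y" .
  qed
  then show ?thesis unfolding recursive_def by blast
qed

lemma triangle_mono: "m \<le> n \<Longrightarrow> triangle m \<le> triangle n"
  by (induction n) (auto simp: le_Suc_eq)

text \<open>The pair \<open>(a, b)\<close> is coded by \<open>triangle (a + b) + a\<close>, so its
  diagonal \<open>a + b\<close> is the least \<open>s\<close> with
  \<open>n < triangle (Suc s)\<close>; truncated subtraction turns this inequality into an equation
  with 0, as minimisation requires.\<close>

lemma sum_prod_decode:
  "(LEAST s. Suc n - triangle (Suc s) = 0) = fst (prod_decode n) + snd (prod_decode n)"
proof -
  obtain a b where ab: "prod_decode n = (a, b)" by fastforce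
  then have n: "n = triangle (a + b) + a"
    using prod_decode_inverse[of n] by (simp add: prod_encode_def)
  have "(LEAST s. Suc n - triangle (Suc s) = 0) = a + b"
  proof (rule Least_equality)
    fix s assume "Suc n - triangle (Suc s) = 0"
    then have "\<not> triangle (Suc s) \<le> triangle (a + b)" using n by simp
    then show "a + b \<le> s" using triangle_mono[of "Suc s" "a + b"] by linarith
  qed (simp add: n)
  then show ?thesis using ab by simp
qed

lemma prod_decode_triangle:
  "fst (prod_decode n) = n - triangle (fst (prod_decode n) + snd (prod_decode n))"
proof -
  obtain a b where ab: "prod_decode n = (a, b)" by fastforce
  then have n: "n = triangle (a + b) + a"
    using prod_decode_inverse[of n] by (simp add: prod_encode_def)
  show ?thesis using n ab by simp
qed

lemma recursive_sum_prod_decode0: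
  "recursive 1 (\<lambda>xs. fst (prod_decode (xs ! 0)) + snd (prod_decode (xs ! 0)))"
proof -
  have "recursive 1 (\<lambda>xs. LEAST s. (\<lambda>xs. Suc (xs ! 1) - triangle (Suc (xs ! 0))) (s # xs) = 0)"
  proof (rule recursive_Least)
    fix xs :: "nat list"
    show "\<exists>n. Suc ((n # xs) ! 1) - triangle (Suc ((n # xs) ! 0)) = 0"
      by (rule exI[of _ "xs ! 0"]) simp
  qed (intro recursive_diff recursive_triangle recursive_Suc recursive_proj; simp)
  then show ?thesis by (simp add: sum_prod_decode del: triangle_Suc diff_is_0_eq)
qed

lemma recursive_fst_prod_decode0: "recursive 1 (\<lambda>xs. fst (prod_decode (xs ! 0)))"
proof -
  have "recursive 1 (\<lambda>xs. xs ! 0 -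
      triangle (fst (prod_decode (xs ! 0)) + snd (prod_decode (xs ! 0))))"
    by (intro recursive_diff recursive_triangle recursive_proj recursive_sum_prod_decode0) auto
  then show ?thesis using prod_decode_triangle by simp
qed

lemma recursive_snd_prod_decode0: "recursive 1 (\<lambda>xs. snd (prod_decode (xs ! 0)))"
proof -
  have "recursive 1 (\<lambda>xs. (fst (prod_decode (xs ! 0)) + snd (prod_decode (xs ! 0)))
      - fst (prod_decode (xs ! 0)))"
    by (intro recursive_diff recursive_sum_prod_decode0 recursive_fst_prod_decode0)
  then show ?thesis by simp
qed

section \<open>Unary functions, with pairs for several arguments\<close>

lemma recursive_1_iff: "recursive 1 (\<lambda>xs. f (xs ! 0)) \<longleftrightarrow> computable_fun f"
proof -
  have "computes 1 t (\<lambda>xs. f (xs ! 0)) \<longleftrightarrow> (\<forall>x y. reval t [x] y \<longleftrightarrow> Some (f x) = Some y)" for t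
    unfolding computes_def by (fastforce simp: length_Suc_conv)
  then show ?thesis
    unfolding recursive_def computable_fun_def partial_computable_def by simp
qed

lemma recursive_computable_fun:
  "computable_fun f \<Longrightarrow> recursive k F \<Longrightarrow> recursive k (\<lambda>xs. f (F xs))"
  using recursive_comp1[OF iffD2[OF recursive_1_iff], of f k F] by simp

lemma computable_fun_id: "computable_fun (\<lambda>x. x)"
  unfolding recursive_1_iff[symmetric] by (intro recursive_proj) auto

lemma computable_fun_const: "computable_fun (\<lambda>x. c)"
  unfolding recursive_1_iff[symmetric] by (rule recursive_const)

lemma computable_fun_comp: "computable_fun f \<Longrightarrow> computable_fun g \<Longrightarrow> computable_fun (\<lambda>x. f (g x))"
  unfolding recursive_1_iff[symmetric, of g] recursive_1_iff[symmetric, of "\<lambda>x. f (g x)"]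
  by (rule recursive_computable_fun)

lemma computable_fun_prod_encode:
  "computable_fun f \<Longrightarrow> computable_fun g \<Longrightarrow> computable_fun (\<lambda>x. prod_encode (f x, g x))"
  unfolding recursive_1_iff[symmetric] by (rule recursive_prod_encode)

lemma computable_fun_fst: "computable_fun (\<lambda>x. fst (prod_decode x))"
  unfolding recursive_1_iff[symmetric] by (rule recursive_fst_prod_decode0)

lemma computable_fun_snd: "computable_fun (\<lambda>x. snd (prod_decode x))"
  unfolding recursive_1_iff[symmetric] by (rule recursive_snd_prod_decode0)

lemma computable_fun_Suc: "computable_fun Suc"
  unfolding recursive_1_iff[symmetric] by (rule recursive_Suc0)

lemma computable_fun_diff:
  "computable_fun f \<Longrightarrow> computable_fun g \<Longrightarrow> computable_fun (\<lambda>x. f x - g x)"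
  unfolding recursive_1_iff[symmetric] by (rule recursive_diff)

lemma computable_fun_prim:
  assumes "computable_fun f" "computable_fun g"
  shows "computable_fun (\<lambda>z. rec_nat (f (fst (prod_decode z)))
      (\<lambda>n y. g (prod_encode (fst (prod_decode z), prod_encode (n, y)))) (snd (prod_decode z)))"
proof -
  have "recursive (Suc 1) (\<lambda>xs. rec_nat ((\<lambda>xs. f (xs ! 0)) (tl xs))
     (\<lambda>n y. (\<lambda>xs. g (prod_encode (xs ! 2, prod_encode (xs ! 1, xs ! 0)))) (y # n # tl xs)) (hd xs))"
    by (intro recursive_prim recursive_computable_fun[OF assms(1)]
        recursive_computable_fun[OF assms(2)] recursive_prod_encode recursive_proj) auto
  then have "recursive 2 (\<lambda>xs. rec_nat (f (xs ! 1))
     (\<lambda>n y. g (prod_encode (xs ! 1, prod_encode (n, y)))) (xs ! 0))"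
    unfolding Suc_1
    by (rule recursive_cong) (auto simp: eval_nat_numeral length_Suc_conv)
  from recursive_comp2[OF this recursive_snd_prod_decode0 recursive_fst_prod_decode0]
  show ?thesis unfolding recursive_1_iff[symmetric] by simp
qed

lemma computable_fun_Least:
  assumes "computable_fun f" "\<And>x. \<exists>n. f (prod_encode (x, n)) = 0"
  shows "computable_fun (\<lambda>x. LEAST n. f (prod_encode (x, n)) = 0)"
proof -
  have "recursive 1 (\<lambda>xs. LEAST n. (\<lambda>xs. f (prod_encode (xs ! 1, xs ! 0))) (n # xs) = 0)"
    by (intro recursive_Least recursive_computable_fun[OF assms(1)] recursive_prod_encode
        recursive_proj) (auto simp: assms(2))
  then show ?thesis unfolding recursive_1_iff[symmetric] by simp
qed

text \<open>All partiality sits in one minimisation over a total function; strictness of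
  \<open>Comp\<close> makes the composite diverge exactly when the search does. The machines built
  later all have this shape.\<close>

lemma partial_computable_search:
  assumes f: "computable_fun f" and g: "computable_fun g"
  shows "partial_computable (\<lambda>x. if \<exists>n. f (prod_encode (x, n)) = 0
     then Some (g (prod_encode (x, LEAST n. f (prod_encode (x, n)) = 0))) else None)"
proof -
  have "recursive 2 (\<lambda>xs. f (prod_encode (xs ! 1, xs ! 0)))"
    "recursive 2 (\<lambda>xs. g (prod_encode (xs ! 0, xs ! 1)))"
    by (intro recursive_computable_fun[OF f] recursive_computable_fun[OF g]
        recursive_prod_encode recursive_proj; simp)+
  then obtain t u where t: "computes 2 t (\<lambda>xs. f (prod_encode (xs ! 1, xs ! 0)))"
    and u: "computes 2 u (\<lambda>xs. g (prod_encode (xs ! 0, xs ! 1)))"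
    unfolding recursive_def by blast
  have t': "reval t [n, x] y \<longleftrightarrow> f (prod_encode (x, n)) = y" for n x y
    using t unfolding computes_def by auto
  have u': "reval u [x, n] y \<longleftrightarrow> g (prod_encode (x, n)) = y" for n x y
    using u unfolding computes_def by auto
  have mn: "reval (Mn t) [x] n \<longleftrightarrow> (\<exists>n. f (prod_encode (x, n)) = 0) \<and>
      (LEAST n. f (prod_encode (x, n)) = 0) = n" for x n
  proof -
    have "reval (Mn t) [x] n \<longleftrightarrow> f (prod_encode (x, n)) = 0 \<and> (\<forall>m<n. f (prod_encode (x, m)) \<noteq> 0)"
      by (auto simp: reval_Mn_iff t' gr0_conv_Suc)
    also have "\<dots> \<longleftrightarrow> (\<exists>n. f (prod_encode (x, n)) = 0) \<and>
      (LEAST n. f (prod_encode (x, n)) = 0) = n"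
      using LeastI_ex[of "\<lambda>n. f (prod_encode (x, n)) = 0"]
        not_less_Least[of _ "\<lambda>n. f (prod_encode (x, n)) = 0"]
      by (metis (mono_tags, lifting) linorder_neqE_nat)
    finally show ?thesis .
  qed
  have "reval (Comp u [Proj 0, Mn t]) [x] y \<longleftrightarrow> (if \<exists>n. f (prod_encode (x, n)) = 0
     then Some (g (prod_encode (x, LEAST n. f (prod_encode (x, n)) = 0))) else None) = Some y" for x y
    by (auto simp: reval_Comp_iff list_all2_Cons1 mn u')
  then show ?thesis unfolding partial_computable_def by blast
qed

section \<open>Computable functions between encoded types\<close>

class enc =
  fixes enc :: "'a \<Rightarrow> nat"
  assumes inj_enc: "inj enc"

lemma enc_eq_iff: "enc x = enc y \<longleftrightarrow> x = y"
  using inj_enc by (rule inj_eq)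

instantiation nat :: enc
begin
  definition [simp]: "enc (n :: nat) = n"
  instance by standard (simp add: inj_def)
end

instantiation bool :: enc
begin
  definition [simp]: "enc b = (of_bool b :: nat)"
  instance by standard (simp add: inj_def)
end

instantiation prod :: (enc, enc) enc
begin
  definition [simp]: "enc p = prod_encode (enc (fst p), enc (snd p))"
  instance by standard (auto simp: inj_def prod_eq_iff enc_eq_iff)
end

instantiation list :: (enc) enc
begin
  definition enc_list_def: "enc xs = list_encode (map enc xs)"
  instance by standard (auto simp: inj_def enc_list_def list_encode_eq inj_map_eq_map[OF inj_enc])
end

lemma enc_Nil [simp]: "enc [] = 0"
  and enc_Cons [simp]: "enc (x # xs) = Suc (prod_encode (enc x, enc xs))"
  by (simp_all add: enc_list_def)

text \<open>With surjectivity every number can be read as a value, so \<open>dec\<close> turns a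
  bare stage number into the data that it codes.\<close>

class surj_enc = enc +
  assumes surj_enc: "surj (enc :: 'a \<Rightarrow> nat)"

instance nat :: surj_enc
  by standard (auto simp: surj_def)

instance prod :: (surj_enc, surj_enc) surj_enc
proof
  have "n = enc (inv enc (fst (prod_decode n)) :: 'a, inv enc (snd (prod_decode n)) :: 'b)" for n
    by (simp add: surj_f_inv_f[OF surj_enc])
  then show "surj (enc :: 'a \<times> 'b \<Rightarrow> nat)" unfolding surj_def by blast
qed

instance list :: (surj_enc) surj_enc
proof
  have "n = enc (map (inv enc) (list_decode n) :: 'a list)" for n
    by (simp add: enc_list_def o_def surj_f_inv_f[OF surj_enc])
  then show "surj (enc :: 'a list \<Rightarrow> nat)" unfolding surj_def by blast
qed

definition dec :: "nat \<Rightarrow> 'a::surj_enc" where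
  "dec = inv enc"

lemma enc_dec: "enc (dec n :: 'a::surj_enc) = n"
  unfolding dec_def by (rule surj_f_inv_f[OF surj_enc])

lemma dec_enc: "dec (enc x) = x"
  unfolding dec_def by (rule inv_f_f[OF inj_enc])

lemma length_le_enc: "length xs \<le> enc xs"
proof (induction xs)
  case (Cons x xs)
  then show ?case using le_prod_encode_2[of "enc xs" "enc x"] by simp
qed simp

definition computable :: "('a::enc \<Rightarrow> 'b::enc) \<Rightarrow> bool" where
  "computable f \<longleftrightarrow> (\<exists>g. computable_fun g \<and> (\<forall>x. g (enc x) = enc (f x)))"

named_theorems computable_intros

lemma computableI: "computable_fun g \<Longrightarrow> (\<And>x. g (enc x) = enc (f x)) \<Longrightarrow> computable f"
  unfolding computable_def by blast

lemma computableE: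
  assumes "computable f"
  obtains g where "computable_fun g" "\<And>x. g (enc x) = enc (f x)"
  using assms unfolding computable_def by blast

lemma computable_nat_iff: "computable f \<longleftrightarrow> computable_fun (f :: nat \<Rightarrow> nat)"
proof
  assume "computable f"
  then obtain g where "computable_fun g" "\<And>x. g (enc x) = enc (f x)"
    using computableE by blast
  moreover from this have "g = f" by (intro ext) simp
  ultimately show "computable_fun f" by simp
qed (auto intro: computableI)

lemma computable_id [computable_intros]: "computable (\<lambda>x. x)"
  by (rule computableI[OF computable_fun_id]) simp

lemma computable_const [computable_intros]: "computable (\<lambda>x. c)"
  by (rule computableI[OF computable_fun_const[of "enc c"]]) simp

lemma computable_comp:
  assumes "computable f" "computable g"
  shows "computable (\<lambda>x. f (g x))"
proof -
  obtain f' where "computable_fun f'" "\<And>x. f' (enc x) = enc (f x)"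
    using assms(1) unfolding computable_def by blast
  moreover obtain g' where "computable_fun g'" "\<And>x. g' (enc x) = enc (g x)"
    using assms(2) unfolding computable_def by blast
  ultimately show ?thesis by (intro computableI[OF computable_fun_comp[of f' g']]) auto
qed

lemma computable_Pair [computable_intros]:
  assumes "computable f" "computable g"
  shows "computable (\<lambda>x. (f x, g x))"
proof -
  obtain f' where "computable_fun f'" "\<And>x. f' (enc x) = enc (f x)"
    using assms(1) unfolding computable_def by blast
  moreover obtain g' where "computable_fun g'" "\<And>x. g' (enc x) = enc (g x)"
    using assms(2) unfolding computable_def by blast
  ultimately show ?thesis by (intro computableI[OF computable_fun_prod_encode[of f' g']]) auto
qed

lemma computable_comp2:
  assumes "computable (\<lambda>p. f (fst p) (snd p))" "computable g" "computable h"
  shows "computable (\<lambda>x. f (g x) (h x))"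
  using computable_comp[OF assms(1) computable_Pair[OF assms(2,3)]] by simp

lemma computable_fst [computable_intros]: "computable f \<Longrightarrow> computable (\<lambda>x. fst (f x))"
  by (rule computable_comp[of fst]) (rule computableI[OF computable_fun_fst], simp)

lemma computable_snd [computable_intros]: "computable f \<Longrightarrow> computable (\<lambda>x. snd (f x))"
  by (rule computable_comp[of snd]) (rule computableI[OF computable_fun_snd], simp)

lemma computable_Suc [computable_intros]: "computable f \<Longrightarrow> computable (\<lambda>x. Suc (f x))"
  by (rule computable_comp[of Suc]) (rule computableI[OF computable_fun_Suc], simp)

lemma computable_diff [computable_intros]:
  assumes "computable f" "computable g" shows "computable (\<lambda>x. f x - g x :: nat)"
proof -
  have "computable (\<lambda>p :: nat \<times> nat. fst p - snd p)"
    by (rule computableI[OF computable_fun_diff[OF computable_fun_fst computable_fun_snd]]) simp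
  then show ?thesis using assms by (rule computable_comp2)
qed

lemma computable_enc [computable_intros]: "computable f \<Longrightarrow> computable (\<lambda>x. enc (f x))"
  by (rule computable_comp[of enc]) (rule computableI[OF computable_fun_id], simp)

lemma computable_dec [computable_intros]: "computable f \<Longrightarrow> computable (\<lambda>x. dec (f x))"
  by (rule computable_comp[of dec]) (rule computableI[OF computable_fun_id], simp_all only: enc_dec enc_nat_def)

lemma computable_rec_nat [computable_intros]:
  assumes "computable f" "computable (\<lambda>p. g (fst p) (fst (snd p)) (snd (snd p)))" "computable h"
  shows "computable (\<lambda>x. rec_nat (f x) (\<lambda>n y. g x n y) (h x))"
proof -
  obtain f' where f': "computable_fun f'" "\<And>x. f' (enc x) = enc (f x)"
    using assms(1) unfolding computable_def by blast
  obtain g' where g': "computable_fun g'"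
      "\<And>p. g' (enc p) = enc (g (fst p) (fst (snd p)) (snd (snd p)))"
    using assms(2) unfolding computable_def by blast
  have g'': "g' (prod_encode (enc x, prod_encode (n, enc y))) = enc (g x n y)" for x n y
    using g'(2)[of "(x, n, y)"] by simp
  have "rec_nat (f' (enc x)) (\<lambda>n y. g' (prod_encode (enc x, prod_encode (n, y)))) n
      = enc (rec_nat (f x) (\<lambda>n y. g x n y) n)" for x n
    by (induction n) (auto simp: f' g'')
  then have "computable (\<lambda>p. rec_nat (f (fst p)) (\<lambda>n y. g (fst p) n y) (snd p))"
    by (intro computableI[OF computable_fun_prim[OF f'(1) g'(1)]]) simp
  from computable_comp[OF this computable_Pair[OF computable_id assms(3)]]
  show ?thesis by simp
qed

section \<open>Booleans, arithmetic, bounded quantifiers and search\<close>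

lemma computable_If [computable_intros]:
  assumes "computable c" "computable f" "computable g"
  shows "computable (\<lambda>x. if c x then f x else g x)"
proof -
  have "computable (\<lambda>x. rec_nat (g x) (\<lambda>_ _. f x) (enc (c x)))"
    by (intro computable_intros assms computable_comp[OF assms(2)])
  also have "(\<lambda>x. rec_nat (g x) (\<lambda>_ _. f x) (enc (c x))) = (\<lambda>x. if c x then f x else g x)"
    by auto
  finally show ?thesis .
qed

lemma computable_Not [computable_intros]:
  assumes "computable P" shows "computable (\<lambda>x. \<not> P x)"
proof -
  have "computable (\<lambda>x. if P x then False else True)" by (intro computable_intros assms)
  moreover have "(\<lambda>x. if P x then False else True) = (\<lambda>x. \<not> P x)" by auto
  ultimately show ?thesis by simp
qed

lemma computable_conj [computable_intros]:
  assumes "computable P" "computable Q" shows "computable (\<lambda>x. P x \<and> Q x)"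
proof -
  have "computable (\<lambda>x. if P x then Q x else False)" by (intro computable_intros assms)
  moreover have "(\<lambda>x. if P x then Q x else False) = (\<lambda>x. P x \<and> Q x)" by auto
  ultimately show ?thesis by (simp only:)
qed

lemma computable_disj [computable_intros]:
  assumes "computable P" "computable Q" shows "computable (\<lambda>x. P x \<or> Q x)"
  using computable_Not[OF computable_conj[OF assms[THEN computable_Not]]] by simp

lemma computable_le [computable_intros]:
  assumes "computable f" "computable g" shows "computable (\<lambda>x. f x \<le> (g x :: nat))"
proof -
  have "computable (\<lambda>x. rec_nat True (\<lambda>_ _. False) (f x - g x))"
    by (intro computable_intros assms)
  moreover have "rec_nat True (\<lambda>_ _. False) (n - m) \<longleftrightarrow> n \<le> m" for n m :: nat
    by (cases "n - m") auto
  ultimately show ?thesis by simp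
qed

lemma computable_less [computable_intros]:
  assumes "computable f" "computable g" shows "computable (\<lambda>x. f x < (g x :: nat))"
  using computable_le[OF computable_Suc[OF assms(1)] assms(2)] by (simp add: Suc_le_eq)

lemma computable_eq [computable_intros]:
  assumes "computable f" "computable g" shows "computable (\<lambda>x. f x = g x)"
proof -
  have "computable (\<lambda>x. enc (f x) \<le> enc (g x) \<and> enc (g x) \<le> enc (f x))"
    by (intro computable_intros assms)
  moreover have "enc a \<le> enc b \<and> enc b \<le> enc a \<longleftrightarrow> a = b" for a b :: 'b
    by (metis antisym enc_eq_iff order_refl)
  ultimately show ?thesis by simp
qed

lemma computable_add [computable_intros]:
  assumes "computable f" "computable g" shows "computable (\<lambda>x. f x + g x :: nat)"
proof -
  have "computable (\<lambda>x. rec_nat (g x) (\<lambda>_ y. Suc y) (f x))"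
    by (intro computable_intros assms)
  moreover have "rec_nat m (\<lambda>_ y. Suc y) n = n + m" for n m by (induction n) auto
  ultimately show ?thesis by simp
qed

lemma computable_mult [computable_intros]:
  assumes "computable f" "computable g" shows "computable (\<lambda>x. f x * g x :: nat)"
proof -
  have "computable (\<lambda>x. rec_nat 0 (\<lambda>_ y. g x + y) (f x))"
    by (intro computable_intros assms computable_comp[OF assms(2)])
  moreover have "rec_nat 0 (\<lambda>_ y. m + y) n = n * m" for n m :: nat by (induction n) auto
  ultimately show ?thesis by simp
qed

lemma computable_power [computable_intros]:
  assumes "computable f" "computable g" shows "computable (\<lambda>x. f x ^ g x :: nat)"
proof -
  have "computable (\<lambda>x. rec_nat 1 (\<lambda>_ y. f x * y) (g x))"
    by (intro computable_intros assms computable_comp[OF assms(1)])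
  moreover have "rec_nat 1 (\<lambda>_ y. m * y) n = m ^ n" for n m :: nat by (induction n) auto
  ultimately show ?thesis by simp
qed

lemma computable_bounded_all [computable_intros]:
  fixes P :: "_ \<Rightarrow> nat \<Rightarrow> bool"
  assumes "computable (\<lambda>p. P (fst p) (snd p))" "computable h"
  shows "computable (\<lambda>x. \<forall>m<h x. P x m)"
proof -
  have "computable (\<lambda>x. rec_nat True (\<lambda>n b. b \<and> P x n) (h x))"
    by (intro computable_intros assms computable_comp2[of P, OF assms(1)])
  moreover have "rec_nat True (\<lambda>n b. b \<and> P x n) m \<longleftrightarrow> (\<forall>n<m. P x n)" for x m
    by (induction m) (auto simp: less_Suc_eq)
  ultimately show ?thesis by simp
qed

lemma computable_bounded_ex [computable_intros]:
  fixes P :: "_ \<Rightarrow> nat \<Rightarrow> bool"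
  assumes "computable (\<lambda>p. P (fst p) (snd p))" "computable h"
  shows "computable (\<lambda>x. \<exists>m<h x. P x m)"
  using computable_Not[OF computable_bounded_all[OF computable_Not[OF assms(1)] assms(2)]] by simp

lemma computable_sum [computable_intros]:
  fixes f :: "_ \<Rightarrow> nat \<Rightarrow> nat"
  assumes "computable (\<lambda>p. f (fst p) (snd p))" "computable h"
  shows "computable (\<lambda>x. \<Sum>m<h x. f x m :: nat)"
proof -
  have "computable (\<lambda>x. rec_nat 0 (\<lambda>n s. s + f x n) (h x))"
    by (intro computable_intros assms computable_comp2[of f, OF assms(1)])
  moreover have "rec_nat 0 (\<lambda>n s. s + f x n) m = (\<Sum>n<m. f x n)" for x m
    by (induction m) auto
  ultimately show ?thesis by simp
qed

text \<open>Without surjectivity the search could diverge on numbers that code nothing.\<close>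

lemma computable_Least:
  fixes P :: "'a::surj_enc \<Rightarrow> nat \<Rightarrow> bool"
  assumes P: "computable (\<lambda>p. P (fst p) (snd p))" and ex: "\<And>x. \<exists>n. P x n"
  shows "computable (\<lambda>x. LEAST n. P x n)"
proof -
  have "computable (\<lambda>p. if P (fst p) (snd p) then 0 else 1 :: nat)"
    by (intro computable_intros P)
  then obtain g where g: "computable_fun g"
    "\<And>p. g (enc p) = enc (if P (fst p) (snd p) then 0 else 1 :: nat)"
    unfolding computable_def by blast
  have *: "g (prod_encode (enc x, n)) = 0 \<longleftrightarrow> P x n" for x n
    using g(2)[of "(x, n)"] by simp
  have "\<exists>n. g (prod_encode (z, n)) = 0" for z
    using surjD[OF surj_enc, of z] ex * by metis
  from computable_fun_Least[OF g(1) this] show ?thesis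
    by (rule computableI) (simp add: *)
qed

lemma partial_computable_searchI:
  fixes g :: "nat \<Rightarrow> nat \<Rightarrow> nat"
  assumes P: "computable (\<lambda>p. P (fst p) (snd p))" and g: "computable (\<lambda>p. g (fst p) (snd p))"
  shows "partial_computable (\<lambda>x. if \<exists>n. P x n then Some (g x (LEAST n. P x n)) else None)"
proof -
  have "computable (\<lambda>p. if P (fst p) (snd p) then 0 else 1 :: nat)"
    by (intro computable_intros P)
  then obtain f where f: "computable_fun f"
    "\<And>p. f (enc p) = enc (if P (fst p) (snd p) then 0 else 1 :: nat)"
    unfolding computable_def by blast
  obtain h where h: "computable_fun h" "\<And>p. h (enc p) = enc (g (fst p) (snd p))"
    using g unfolding computable_def by blast
  have f': "f (prod_encode (x, n)) = 0 \<longleftrightarrow> P x n"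
    and h': "h (prod_encode (x, n)) = g x n" for x n
    using f(2)[of "(x, n)"] h(2)[of "(x, n)"] by auto
  show ?thesis using partial_computable_search[OF f(1) h(1)] unfolding f' h' .
qed

lemma computable_div [computable_intros]:
  assumes "computable f" "computable g" shows "computable (\<lambda>x. f x div g x :: nat)"
proof -
  \<comment> \<open>The disjunct \<open>snd p = 0\<close> keeps the search total and makes it return
    0, the value of division by zero.\<close>
  have "computable (\<lambda>p :: nat \<times> nat. LEAST q. snd p = 0 \<or> fst p < Suc q * snd p)"
  proof (rule computable_Least)
    fix p :: "nat \<times> nat"
    have "snd p = 0 \<or> fst p < Suc (fst p) * snd p" by (cases "snd p") auto
    then show "\<exists>q. snd p = 0 \<or> fst p < Suc q * snd p" by blast
  qed (intro computable_intros)
  moreover have "(LEAST q. n = 0 \<or> m < Suc q * n) = m div n" for m n :: nat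
  proof (cases "n = 0")
    case False
    show ?thesis
    proof (rule Least_equality)
      show "n = 0 \<or> m < Suc (m div n) * n"
        using False dividend_less_div_times[of n m] by simp
      show "m div n \<le> q" if "n = 0 \<or> m < Suc q * n" for q
        using that False less_mult_imp_div_less[of m "Suc q" n] by simp
    qed
  qed simp
  ultimately have "computable (\<lambda>p :: nat \<times> nat. fst p div snd p)" by simp
  then show ?thesis using assms by (rule computable_comp2)
qed

lemma computable_even [computable_intros]:
  assumes "computable f" shows "computable (\<lambda>x. even (f x :: nat))"
proof -
  have "computable (\<lambda>x. 2 * (f x div 2) = f x)" by (intro computable_intros assms)
  moreover have "2 * (n div 2) = n \<longleftrightarrow> even n" for n :: nat by presburger
  ultimately show ?thesis by simp
qed

lemma computable_prod_encode [computable_intros]: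
  assumes "computable f" shows "computable (\<lambda>x. prod_encode (f x))"
  using computable_enc[OF assms] by simp

lemma computable_prod_decode [computable_intros]:
  "computable f \<Longrightarrow> computable (\<lambda>x. prod_decode (f x))"
  by (rule computable_comp[of prod_decode])
     (rule computableI[OF computable_fun_id], simp_all)

section \<open>List operations\<close>

lemma computable_Cons [computable_intros]:
  assumes "computable f" "computable g" shows "computable (\<lambda>x. f x # g x)"
proof -
  have "computable_fun (\<lambda>z. Suc (prod_encode (fst (prod_decode z), snd (prod_decode z))))"
    unfolding computable_nat_iff[symmetric] by (intro computable_intros)
  then have "computable (\<lambda>p. fst p # snd p)" by (rule computableI) simp
  then show ?thesis using assms by (rule computable_comp2)
qed

lemma computable_case_list [computable_intros]:
  assumes "computable f" "computable (\<lambda>p. g (fst p) (fst (snd p)) (snd (snd p)))" "computable l"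
  shows "computable (\<lambda>x. case l x of [] \<Rightarrow> f x | a # as \<Rightarrow> g x a as)"
proof -
  obtain f' where f': "computable_fun f'" "\<And>x. f' (enc x) = enc (f x)"
    using assms(1) unfolding computable_def by blast
  obtain g' where g': "computable_fun g'"
      "\<And>p. g' (enc p) = enc (g (fst p) (fst (snd p)) (snd (snd p)))"
    using assms(2) unfolding computable_def by blast
  obtain l' where l': "computable_fun l'" "\<And>x. l' (enc x) = enc (l x)"
    using assms(3) unfolding computable_def by blast
  have g'': "g' (prod_encode (enc x, prod_encode (enc a, enc as))) = enc (g x a as)" for x a as
    using g'(2)[of "(x, a, as)"] by simp
  have "computable_fun (\<lambda>z. if l' z = 0 then f' z else
     g' (prod_encode (z, prod_encode (fst (prod_decode (l' z - 1)), snd (prod_decode (l' z - 1))))))"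
    unfolding computable_nat_iff[symmetric]
    by (intro computable_intros f'(1)[folded computable_nat_iff] l'(1)[folded computable_nat_iff]
        computable_comp[OF g'(1)[folded computable_nat_iff]])
  then show ?thesis
    by (rule computableI) (auto simp: f' g'' l' split: list.split)
qed

lemma computable_comp3:
  assumes "computable (\<lambda>p. g (fst p) (fst (snd p)) (snd (snd p)))"
    "computable f1" "computable f2" "computable f3"
  shows "computable (\<lambda>x. g (f1 x) (f2 x) (f3 x))"
  using computable_comp[OF assms(1) computable_Pair[OF assms(2) computable_Pair[OF assms(3,4)]]]
  by simp

text \<open>List recursion becomes iteration on the pair of accumulator and remaining list. Steps on
  the empty list change nothing, so any bound on the length will do as number of steps; by
  \<open>length_le_enc\<close> the code of the list is one.\<close>

lemma computable_fold [computable_intros]: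
  fixes g :: "'a::enc \<Rightarrow> 'b::enc \<Rightarrow> 'c::enc \<Rightarrow> 'c"
  assumes "computable (\<lambda>p. g (fst p) (fst (snd p)) (snd (snd p)))" "computable l" "computable z"
  shows "computable (\<lambda>x. fold (\<lambda>a s. g x a s) (l x) (z x))"
proof -
  define step where "step x p = (case snd p of [] \<Rightarrow> p | a # as \<Rightarrow> (g x a (fst p), as))"
    for x and p :: "'c \<times> 'b list"
  have "computable (\<lambda>p. step (fst p) (snd p))"
    unfolding step_def
    by (intro computable_intros computable_comp3[of g, OF assms(1)])
  then have st: "computable (\<lambda>x. step (f x) (h x))" if "computable f" "computable h" for f h
    using that by (rule computable_comp2)
  have "computable (\<lambda>x. fst (rec_nat (z x, l x) (\<lambda>n s. step x s) (enc (l x))))"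
    by (intro computable_intros assms st)
  moreover have "rec_nat (s, as) (\<lambda>n s. step x s) n = (fold (g x) (take n as) s, drop n as)"
    for x s as n
  proof (induction n)
    case (Suc n)
    show ?case
    proof (cases "n < length as")
      case True
      then show ?thesis using Suc Cons_nth_drop_Suc[OF True, symmetric]
        by (simp add: step_def take_Suc_conv_app_nth)
    qed (use Suc in \<open>simp add: step_def\<close>)
  qed simp
  ultimately show ?thesis by (simp add: length_le_enc)
qed

lemma computable_rev [computable_intros]:
  assumes "computable f" shows "computable (\<lambda>x. rev (f x))"
proof -
  have "computable (\<lambda>x. fold (\<lambda>a s. a # s) (f x) [])" by (intro computable_intros assms)
  then show ?thesis by (simp add: fold_Cons_rev)
qed

lemma computable_foldr [computable_intros]:
  assumes "computable (\<lambda>p. g (fst p) (fst (snd p)) (snd (snd p)))" "computable l" "computable z"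
  shows "computable (\<lambda>x. foldr (\<lambda>a s. g x a s) (l x) (z x))"
proof -
  have "computable (\<lambda>x. fold (\<lambda>a s. g x a s) (rev (l x)) (z x))"
    by (intro computable_fold computable_rev assms)
  then show ?thesis by (simp add: foldr_conv_fold)
qed

lemma computable_length [computable_intros]:
  assumes "computable f" shows "computable (\<lambda>x. length (f x))"
proof -
  have "computable (\<lambda>x. fold (\<lambda>a s. Suc s) (f x) 0)" by (intro computable_intros assms)
  moreover have "fold (\<lambda>a s. Suc s) xs n = n + length xs" for n and xs :: "'b list"
    by (induction xs arbitrary: n) auto
  ultimately show ?thesis by simp
qed

lemma computable_append [computable_intros]:
  assumes "computable f" "computable g" shows "computable (\<lambda>x. f x @ g x)"
proof -
  have "computable (\<lambda>x. foldr (\<lambda>a s. a # s) (f x) (g x))" by (intro computable_intros assms)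
  moreover have "foldr (\<lambda>a s. a # s) xs ys = xs @ ys" for xs ys :: "'b list" by (induction xs) auto
  ultimately show ?thesis by simp
qed

lemma computable_map [computable_intros]:
  assumes "computable (\<lambda>p. g (fst p) (snd p))" "computable l"
  shows "computable (\<lambda>x. map (\<lambda>a. g x a) (l x))"
proof -
  have "computable (\<lambda>x. foldr (\<lambda>a s. g x a # s) (l x) [])"
    by (intro computable_intros assms(2) computable_comp2[of g, OF assms(1)])
  moreover have "foldr (\<lambda>a s. g x a # s) as [] = map (\<lambda>a. g x a) as" for x as
    by (induction as) auto
  ultimately show ?thesis by simp
qed

lemma computable_concat [computable_intros]:
  assumes "computable f" shows "computable (\<lambda>x. concat (f x))"
proof -
  have "computable (\<lambda>x. foldr (\<lambda>a s. a @ s) (f x) [])" by (intro computable_intros assms)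
  then show ?thesis by (simp add: concat_conv_foldr)
qed

lemma computable_ball_set [computable_intros]:
  assumes "computable (\<lambda>p. P (fst p) (snd p))" "computable l"
  shows "computable (\<lambda>x. \<forall>a\<in>set (l x). P x a)"
proof -
  have "computable (\<lambda>x. foldr (\<lambda>a s. P x a \<and> s) (l x) True)"
    by (intro computable_intros assms(2) computable_comp2[of P, OF assms(1)])
  moreover have "foldr (\<lambda>a s. P x a \<and> s) as True \<longleftrightarrow> (\<forall>a\<in>set as. P x a)" for x as
    by (induction as) auto
  ultimately show ?thesis by simp
qed

lemma computable_bex_set [computable_intros]:
  assumes "computable (\<lambda>p. P (fst p) (snd p))" "computable l"
  shows "computable (\<lambda>x. \<exists>a\<in>set (l x). P x a)"
  using computable_Not[OF computable_ball_set[OF computable_Not[OF assms(1)] assms(2)]] by simp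

lemma computable_upt [computable_intros]:
  assumes "computable f" shows "computable (\<lambda>x. [0..<f x])"
proof -
  have "computable (\<lambda>x. rec_nat [] (\<lambda>n s. s @ [n]) (f x))" by (intro computable_intros assms)
  moreover have "rec_nat [] (\<lambda>n s. s @ [n]) n = [0..<n]" for n by (induction n) auto
  ultimately show ?thesis by simp
qed

lemma computable_drop [computable_intros]:
  assumes "computable f" "computable g" shows "computable (\<lambda>x. drop (f x) (g x))"
proof -
  have "computable (\<lambda>x. rec_nat (g x) (\<lambda>n s. case s of [] \<Rightarrow> [] | a # as \<Rightarrow> as) (f x))"
    by (intro computable_intros assms)
  moreover have "rec_nat as (\<lambda>n s. case s of [] \<Rightarrow> [] | a # as \<Rightarrow> as) n = drop n as" for n and as :: "'b list"
    by (induction n) (auto simp: drop_Suc tl_drop[symmetric] split: list.split)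
  ultimately show ?thesis by simp
qed

lemma computable_take [computable_intros]:
  assumes "computable f" "computable g" shows "computable (\<lambda>x. take (f x) (g x))"
proof -
  have "computable (\<lambda>x. rev (drop (length (g x) - f x) (rev (g x))))"
    by (intro computable_intros assms)
  moreover have "rev (drop (length as - n) (rev as)) = take n as" for n and as :: "'b list"
    by (cases "n \<le> length as") (auto simp: drop_rev)
  ultimately show ?thesis by simp
qed

lemma computable_replicate [computable_intros]:
  assumes "computable f" "computable g" shows "computable (\<lambda>x. replicate (f x) (g x))"
proof -
  have "computable (\<lambda>x. rec_nat [] (\<lambda>n s. g x # s) (f x))"
    by (intro computable_intros assms(1) computable_comp[OF assms(2)])
  moreover have "rec_nat [] (\<lambda>n s. a # s) n = replicate n a" for n and a :: 'b by (induction n) auto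
  ultimately show ?thesis by simp
qed

section \<open>Binary strings as numbers\<close>

lemma computable_nat_of_bl [computable_intros]:
  assumes "computable f" shows "computable (\<lambda>x. nat_of_bl (f x))"
proof -
  have "computable (\<lambda>x. foldr (\<lambda>b s. 2 * s + (if b then 2 else 1)) (f x) (0 :: nat))"
    by (intro computable_intros assms)
  moreover have "foldr (\<lambda>b s. 2 * s + (if b then 2 else 1)) bs 0 = nat_of_bl bs" for bs
    by (induction bs) auto
  ultimately show ?thesis by simp
qed

lemma bl_of_nat_of_bl [simp]: "bl_of_nat (nat_of_bl bs) = bs"
  by (induction bs) auto

lemma nat_of_bl_of_nat [simp]: "nat_of_bl (bl_of_nat n) = n"
  by (induction n rule: bl_of_nat.induct) (auto elim!: oddE evenE)

lemma computable_bl_of_nat [computable_intros]: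
  assumes "computable f" shows "computable (\<lambda>x. bl_of_nat (f x))"
proof -
  define step where "step p = (if fst p = 0 then p
      else ((fst p - 1) div 2, odd (fst p - 1) # snd p))" for p :: "nat \<times> bool list"
  have "computable step" unfolding step_def by (intro computable_intros)
  then have st: "computable (\<lambda>x. step (f x))" if "computable f" for f :: "'b::enc \<Rightarrow> _"
    using that by (rule computable_comp)
  have "computable (\<lambda>x. rev (snd (rec_nat (f x, []) (\<lambda>n s. step s) (f x))))"
    by (intro computable_intros assms st)
  \<comment> \<open>Loop invariant: \<open>m\<close> is still unread and \<open>bs\<close> holds the
    bits read so far in reverse. Since \<open>m \<le> n - k\<close>, nothing is left after
    \<open>n\<close> rounds.\<close>
  moreover have "\<exists>m bs. rec_nat (n, []) (\<lambda>n s. step s) k = (m, bs) \<and> m \<le> n - k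
     \<and> bl_of_nat n = rev bs @ bl_of_nat m" for n k
  proof (induction k)
    case (Suc k)
    then obtain m bs where *: "rec_nat (n, []) (\<lambda>n s. step s) k = (m, bs)" "m \<le> n - k"
     "bl_of_nat n = rev bs @ bl_of_nat m" by blast
    show ?case using * by (cases m) (auto simp: step_def)
  qed auto
  from this[of n n for n] have "rev (snd (rec_nat (n, []) (\<lambda>n s. step s) n)) = bl_of_nat n" for n
    by (metis bl_of_nat.simps(1) append_Nil2 diff_self_eq_0 le_zero_eq snd_conv)
  ultimately show ?thesis by simp
qed

section \<open>Certificates for evaluations\<close>

lemma computable_list_decode [computable_intros]:
  "computable f \<Longrightarrow> computable (\<lambda>x. list_decode (f x))"
  by (rule computable_comp[of list_decode])
     (rule computableI[OF computable_fun_id], simp_all add: enc_list_def map_idI)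

lemma computable_mem [computable_intros]:
  assumes "computable f" "computable l" shows "computable (\<lambda>x. f x \<in> set (l x))"
proof -
  have "computable (\<lambda>x. \<exists>a\<in>set (l x). a = f x)"
    by (intro computable_intros assms(2) computable_comp[OF assms(1)])
  then show ?thesis by simp
qed

text \<open>A replacement for \<open>!\<close> with a default, so that it is defined, and
  computable, out of range as well.\<close>

definition nth0 :: "nat list \<Rightarrow> nat \<Rightarrow> nat" where
  "nth0 xs i = (case drop i xs of [] \<Rightarrow> 0 | x # _ \<Rightarrow> x)"

lemma nth0_eq_nth: "i < length xs \<Longrightarrow> nth0 xs i = xs ! i"
  by (simp add: nth0_def flip: Cons_nth_drop_Suc)

lemma computable_nth0 [computable_intros]:
  "computable f \<Longrightarrow> computable g \<Longrightarrow> computable (\<lambda>x. nth0 (f x) (g x))"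
  unfolding nth0_def by (intro computable_intros)

fun code :: "recf \<Rightarrow> nat" where
  "code Zero = prod_encode (0, 0)"
| "code Succ = prod_encode (1, 0)"
| "code (Proj i) = prod_encode (2, i)"
| "code (Comp f gs) = prod_encode (3, prod_encode (code f, list_encode (map code gs)))"
| "code (Prim f g) = prod_encode (4, prod_encode (code f, code g))"
| "code (Mn f) = prod_encode (5, code f)"

type_synonym fact = "nat \<times> nat list \<times> nat"

text \<open>A fact \<open>(e, xs, y)\<close> claims that the term with code \<open>e\<close> evaluates to \<open>y\<close> on \<open>xs\<close>.\<close>

definition justified_Comp :: "fact list \<Rightarrow> nat \<Rightarrow> nat list \<Rightarrow> nat \<Rightarrow> bool" where
  "justified_Comp C a xs y \<longleftrightarrow> (\<exists>s\<in>set C. fst s = fst (prod_decode a) \<and> snd (snd s) = y \<and>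
     length (fst (snd s)) = length (list_decode (snd (prod_decode a))) \<and>
     (\<forall>j<length (fst (snd s)).
        (nth0 (list_decode (snd (prod_decode a))) j, xs, nth0 (fst (snd s)) j) \<in> set C))"

definition justified_Prim :: "fact list \<Rightarrow> nat \<Rightarrow> nat \<Rightarrow> nat list \<Rightarrow> nat \<Rightarrow> bool" where
  "justified_Prim C e a xs y \<longleftrightarrow> (case xs of [] \<Rightarrow> False | n # zs \<Rightarrow>
     if n = 0 then (fst (prod_decode a), zs, y) \<in> set C
     else (\<exists>s\<in>set C. fst s = e \<and> fst (snd s) = (n - 1) # zs \<and>
        (snd (prod_decode a), snd (snd s) # (n - 1) # zs, y) \<in> set C))"

definition justified_Mn :: "fact list \<Rightarrow> nat \<Rightarrow> nat list \<Rightarrow> nat \<Rightarrow> bool" where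
  "justified_Mn C a xs y \<longleftrightarrow> (a, y # xs, 0) \<in> set C \<and>
     (\<forall>m<y. \<exists>s\<in>set C. fst s = a \<and> fst (snd s) = m # xs \<and> snd (snd s) \<noteq> 0)"

text \<open>In every case the quantifiers range over the list \<open>C\<close> or below a number:
  intermediate values are read off facts already listed and never searched for, which makes the
  check decidable.\<close>

definition justified :: "fact list \<Rightarrow> fact \<Rightarrow> bool" where
  "justified C r \<longleftrightarrow> (case r of (e, xs, y) \<Rightarrow> case prod_decode e of (t, a) \<Rightarrow>
     if t = 0 then y = 0
     else if t = 1 then (case xs of [] \<Rightarrow> False | x # _ \<Rightarrow> y = Suc x)
     else if t = 2 then (case drop a xs of [] \<Rightarrow> False | x # _ \<Rightarrow> y = x)
     else if t = 3 then justified_Comp C a xs y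
     else if t = 4 then justified_Prim C e a xs y
     else t = 5 \<and> justified_Mn C a xs y)"

lemmas justified_defs =
  justified_def justified_Comp_def justified_Prim_def justified_Mn_def

text \<open>A fact may cite only facts further down the list, which excludes circular justification.
  Positions and \<open>drop\<close> are used in place of recursion so that the computability rules
  apply directly.\<close>

definition cert :: "fact list \<Rightarrow> bool" where
  "cert C \<longleftrightarrow> (\<forall>i<length C. case drop i C of [] \<Rightarrow> True | r # D \<Rightarrow> justified D r)"

lemma computable_justified_Comp [computable_intros]:
  assumes "computable C" "computable f" "computable g" "computable h"
  shows "computable (\<lambda>x. justified_Comp (C x) (f x) (g x) (h x))"
  unfolding justified_Comp_def by (intro computable_intros assms assms[THEN computable_comp])

lemma computable_justified_Prim [computable_intros]:
  assumes "computable C" "computable e" "computable f" "computable g" "computable h"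
  shows "computable (\<lambda>x. justified_Prim (C x) (e x) (f x) (g x) (h x))"
  unfolding justified_Prim_def by (intro computable_intros assms assms[THEN computable_comp])

lemma computable_justified_Mn [computable_intros]:
  assumes "computable C" "computable f" "computable g" "computable h"
  shows "computable (\<lambda>x. justified_Mn (C x) (f x) (g x) (h x))"
  unfolding justified_Mn_def by (intro computable_intros assms assms[THEN computable_comp])

lemma computable_justified [computable_intros]:
  assumes "computable f" "computable g" shows "computable (\<lambda>x. justified (f x) (g x))"
  unfolding justified_def case_prod_beta
  by (intro computable_intros assms assms[THEN computable_comp])

lemma computable_cert [computable_intros]:
  "computable f \<Longrightarrow> computable (\<lambda>x. cert (f x))"
proof (rule computable_comp[of cert])
  show "computable cert" unfolding cert_def by (intro computable_intros)
qed

lemma cert_Nil [simp]: "cert []"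
  by (simp add: cert_def)

lemma cert_Cons [simp]: "cert (r # C) \<longleftrightarrow> justified C r \<and> cert C"
  by (simp add: cert_def All_less_Suc2)

text \<open>Membership in \<open>C\<close> occurs only positively, so certificates can be merged and
  extended.\<close>

lemma justified_mono:
  assumes "justified C r" "set C \<subseteq> set D" shows "justified D r"
proof -
  note mem = subsetD[OF assms(2)]
  have c: "justified_Comp D a xs y" if j: "justified_Comp C a xs y" for a xs y
  proof -
    obtain s where s: "s \<in> set C" "fst s = fst (prod_decode a)" "snd (snd s) = y"
      "length (fst (snd s)) = length (list_decode (snd (prod_decode a)))"
      and all: "\<forall>j<length (fst (snd s)).
        (nth0 (list_decode (snd (prod_decode a))) j, xs, nth0 (fst (snd s)) j) \<in> set C"
      using j unfolding justified_Comp_def by (elim bexE conjE) (rule that)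
    show ?thesis unfolding justified_Comp_def
      by (rule bexI[of _ s]) (use s all mem in simp_all)
  qed
  have p: "justified_Prim D e a xs y" if j: "justified_Prim C e a xs y" for e a xs y
  proof (cases xs)
    case (Cons n zs)
    show ?thesis
    proof (cases n)
      case (Suc m)
      then obtain v where "(e, m # zs, v) \<in> set C" "(snd (prod_decode a), v # m # zs, y) \<in> set C"
        using j Cons unfolding justified_Prim_def by auto
      then have "\<exists>s\<in>set D. fst s = e \<and> fst (snd s) = m # zs \<and>
          (snd (prod_decode a), snd (snd s) # m # zs, y) \<in> set D"
        by (intro bexI[of _ "(e, m # zs, v)"]) (simp_all add: mem)
      then show ?thesis unfolding justified_Prim_def using Cons Suc by simp
    qed (use j Cons mem in \<open>simp add: justified_Prim_def\<close>)
  qed (use j in \<open>simp add: justified_Prim_def\<close>)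
  have m: "justified_Mn D a xs y" if "justified_Mn C a xs y" for a xs y
    using that unfolding justified_Mn_def by (meson mem)
  show ?thesis
    using assms(1) unfolding justified_def case_prod_beta
    by (simp split: if_splits add: c p m)
qed

lemma cert_append: "cert C \<Longrightarrow> cert D \<Longrightarrow> cert (C @ D)"
  by (induction C) (auto elim: justified_mono)

text \<open>A fact about a coded term cites only facts about that term and its immediate subterms.
  Numbers that code no term may therefore occur in a certificate without harm.\<close>

lemma justified_sound:
  assumes "\<And>t xs y. (code t, xs, y) \<in> set C \<Longrightarrow> reval t xs y" "justified C (code t, xs, y)"
  shows "reval t xs y"
proof (cases t)
  case (Comp f gs)
  then obtain s where "s \<in> set C" "fst s = code f" "snd (snd s) = y"
      "length (fst (snd s)) = length gs"
      and all: "\<forall>j<length gs. (nth0 (map code gs) j, xs, nth0 (fst (snd s)) j) \<in> set C"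
    using assms(2) by (auto simp: justified_defs)
  then obtain ys where ys: "(code f, ys, y) \<in> set C" "length ys = length gs" "fst (snd s) = ys"
    by (metis prod.collapse)
  have "list_all2 (\<lambda>g y. reval g xs y) gs ys"
    unfolding list_all2_conv_all_nth
  proof (intro conjI allI impI)
    fix j assume "j < length gs"
    then have "(code (gs ! j), xs, ys ! j) \<in> set C" using all ys by (auto simp: nth0_eq_nth)
    then show "reval (gs ! j) xs (ys ! j)" by (rule assms(1))
  qed (use ys in simp)
  then show ?thesis using assms(1)[OF ys(1)] Comp by (auto intro: reval.comp)
next
  case (Prim f g)
  show ?thesis
  proof (cases xs)
    case Nil
    then show ?thesis using assms(2) Prim by (auto simp: justified_defs)
  next
    case (Cons n zs)
    show ?thesis
    proof (cases n)
      case 0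
      then show ?thesis using assms(2) Prim Cons
        by (auto simp: justified_defs intro!: reval.prim0 assms(1))
    next
      case (Suc m)
      then obtain v where "(code t, m # zs, v) \<in> set C" "(code g, v # m # zs, y) \<in> set C"
        using assms(2) Prim Cons by (auto simp: justified_defs)
      then have "reval t (m # zs) v" "reval g (v # m # zs) y"
        by (auto intro!: assms(1))
      then show ?thesis using Prim Cons Suc by (auto intro: reval.primS)
    qed
  qed
next
  case (Mn f)
  then have *: "(code f, y # xs, 0) \<in> set C"
      "\<forall>m<y. \<exists>s\<in>set C. fst s = code f \<and> fst (snd s) = m # xs \<and> snd (snd s) \<noteq> 0"
    using assms(2) by (auto simp: justified_defs)
  have "\<exists>z. reval f (m # xs) (Suc z)" if "m < y" for m
  proof -
    from *(2) that have "\<exists>s\<in>set C. fst s = code f \<and> fst (snd s) = m # xs \<and> snd (snd s) \<noteq> 0"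
      by simp
    then obtain v where "(code f, m # xs, v) \<in> set C" "v \<noteq> 0" by auto
    then show ?thesis using assms(1) not0_implies_Suc by blast
  qed
  then show ?thesis using Mn assms(1)[OF *(1)] by (auto intro: reval.mn)
next
  case (Proj i)
  show ?thesis
  proof (cases "i < length xs")
    case True
    then show ?thesis using assms(2) Proj
      by (auto simp: justified_defs simp flip: Cons_nth_drop_Suc)
  qed (use assms(2) Proj in \<open>auto simp: justified_defs\<close>)
qed (use assms(2) in \<open>auto simp: justified_defs split: list.splits\<close>)

lemma cert_sound: "cert C \<Longrightarrow> (code t, xs, y) \<in> set C \<Longrightarrow> reval t xs y"
proof (induction C arbitrary: t xs y)
  case (Cons r C)
  then show ?case using justified_sound[of C t xs y] by auto
qed simp

definition certifiable :: "fact \<Rightarrow> bool" where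
  "certifiable r \<longleftrightarrow> (\<exists>C. cert C \<and> r \<in> set C)"

lemma certifiable_list:
  assumes "\<forall>r\<in>set rs. certifiable r" obtains C where "cert C" "set rs \<subseteq> set C"
  using assms
proof (induction rs arbitrary: thesis)
  case (Cons r rs)
  obtain C where "cert C" "set rs \<subseteq> set C" using Cons.IH Cons.prems(2) by auto
  moreover obtain D where "cert D" "r \<in> set D"
    using Cons.prems(2) unfolding certifiable_def by auto
  ultimately show ?case by (intro Cons.prems(1)[of "D @ C"]) (auto intro: cert_append)
qed (use cert_Nil in blast)

lemma certifiableI:
  assumes "\<forall>r\<in>set rs. certifiable r" "justified rs r" shows "certifiable r"
proof -
  obtain C where "cert C" "set rs \<subseteq> set C" using certifiable_list[OF assms(1)] .
  then have "cert (r # C)" using assms(2) justified_mono by auto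
  then show ?thesis unfolding certifiable_def by (metis list.set_intros(1))
qed

lemma cert_complete: "reval t xs y \<Longrightarrow> certifiable (code t, xs, y)"
proof (induction rule: reval.induct)
  case (zero xs)
  show ?case by (rule certifiableI[of "[]"]) (auto simp: justified_defs)
next
  case (succ x xs)
  show ?case by (rule certifiableI[of "[]"]) (auto simp: justified_defs)
next
  case (proj i xs)
  then show ?case
    by (intro certifiableI[of "[]"]) (auto simp: justified_defs simp flip: Cons_nth_drop_Suc)
next
  case (comp xs gs ys f z)
  have len: "length gs = length ys" using comp(1) by (rule list_all2_lengthD)
  have g: "certifiable (code (gs ! j), xs, ys ! j)" if "j < length ys" for j
    using comp(1) that by (auto simp: list_all2_conv_all_nth)
  show ?case
  proof (rule certifiableI[of "(code f, ys, z) # map (\<lambda>j. (code (gs ! j), xs, ys ! j)) [0..<length ys]"])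
    show "justified ((code f, ys, z) # map (\<lambda>j. (code (gs ! j), xs, ys ! j)) [0..<length ys])
        (code (Comp f gs), xs, z)"
      using len by (auto simp: justified_defs nth0_eq_nth)
  qed (use comp g in auto)
next
  case (prim0 f xs y g)
  then show ?case
    by (intro certifiableI[of "[(code f, xs, y)]"]) (auto simp: justified_defs)
next
  case (primS f g n xs y z)
  then show ?case
    by (intro certifiableI[of "[(code (Prim f g), n # xs, y), (code g, y # n # xs, z)]"])
       (auto simp: justified_defs)
next
  case (mn f n xs)
  \<comment> \<open>The rule gives a nonzero value for each smaller argument; a choice function
    collects them into one finite list of premisses.\<close>
  then have "\<forall>m. \<exists>y. m < n \<longrightarrow> certifiable (code f, m # xs, Suc y)" by blast
  then obtain h where h: "\<And>m. m < n \<Longrightarrow> certifiable (code f, m # xs, Suc (h m))" by metis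
  show ?case
    by (rule certifiableI[of "(code f, n # xs, 0) # map (\<lambda>m. (code f, m # xs, Suc (h m))) [0..<n]"])
       (use mn h in \<open>auto simp: justified_defs\<close>)
qed

text \<open>This takes the place of Kleene's T predicate: evaluation is unbounded search for a
  witness of a decidable relation.\<close>

lemma reval_iff_cert: "reval t xs y \<longleftrightarrow> (\<exists>C. cert C \<and> (code t, xs, y) \<in> set C)"
  using cert_sound cert_complete unfolding certifiable_def by blast

section \<open>Machines from request sequences\<close>

text \<open>The binary numeral with leading bit first. Unlike \<open>nat_of_bl\<close> it forgets
  leading zeros and is meant to be read together with the length.\<close>

definition bval :: "bool list \<Rightarrow> nat" where
  "bval p = fold (\<lambda>b n. 2 * n + (if b then 1 else 0)) p 0"

lemma bval_Nil [simp]: "bval [] = 0"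
  and bval_snoc [simp]: "bval (p @ [b]) = 2 * bval p + (if b then 1 else 0)"
  by (simp_all add: bval_def)

lemma computable_bval [computable_intros]: "computable f \<Longrightarrow> computable (\<lambda>x. bval (f x))"
  unfolding bval_def by (intro computable_intros)

text \<open>A string \<open>p\<close> stands for the dyadic interval that begins at
  \<open>bval p / 2 ^ length p\<close> and has length \<open>1 / 2 ^ length p\<close>; extensions of
  \<open>p\<close> stay inside it.\<close>

lemma bval_append: "bval p * 2 ^ length r \<le> bval (p @ r) \<and> bval (p @ r) < (bval p + 1) * 2 ^ length r"
proof (induction r rule: rev_induct)
  case (snoc b r)
  have "bval (p @ r @ [b]) = 2 * bval (p @ r) + (if b then 1 else 0)"
    using bval_snoc[of "p @ r" b] by simp
  then show ?case using snoc by (auto split: if_splits)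
qed simp

lemma ex_bval: "v < 2 ^ n \<Longrightarrow> \<exists>p. length p = n \<and> bval p = v"
proof (induction n arbitrary: v)
  case (Suc n)
  then have "v div 2 < 2 ^ n" by auto
  then obtain p where "length p = n" "bval p = v div 2" using Suc.IH by blast
  then show ?case by (intro exI[of _ "p @ [odd v]"]) auto
qed simp

lemma Kc_le: "U p = Some \<sigma> \<Longrightarrow> Kc U \<sigma> \<le> enat (length p)"
  unfolding Kc_def by (auto intro: Least_le)

lemma Kc_enatE:
  assumes "Kc U \<sigma> = enat n" obtains p where "U p = Some \<sigma>" "length p = n"
proof -
  have ex: "\<exists>p. U p = Some \<sigma>" using assms unfolding Kc_def by (auto split: if_splits)
  then have "n = (LEAST n. \<exists>p. U p = Some \<sigma> \<and> length p = n)"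
    using assms unfolding Kc_def by simp
  then have "\<exists>p. U p = Some \<sigma> \<and> length p = n"
    using LeastI_ex[of "\<lambda>n. \<exists>p. U p = Some \<sigma> \<and> length p = n"] ex by blast
  then show ?thesis using that by blast
qed

lemma ceiling_div_bounds:
  fixes a b :: nat assumes "b > 0"
  shows "real a / real b \<le> real ((a + b - 1) div b)" "real ((a + b - 1) div b) < real a / real b + 1"
proof -
  let ?q = "(a + b - 1) div b"
  have "(a + b - 1) mod b < b" "b * ?q + (a + b - 1) mod b = a + b - 1"
    using assms by simp_all
  then have "a \<le> b * ?q" "b * ?q < a + b" using assms by linarith+
  then have "real a \<le> real b * real ?q" "real b * real ?q < real a + real b"
    unfolding of_nat_mult[symmetric] of_nat_add[symmetric] by (simp_all only: of_nat_le_iff of_nat_less_iff)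
  then show "real a / real b \<le> real ?q" "real ?q < real a / real b + 1"
    using assms by (simp_all add: field_simps)
qed

text \<open>Request \<open>i\<close>, if active, asks for a description of \<open>out i\<close> of length \<open>len i\<close>. Spending one
  extra bit leaves room to round the left end of the next free interval up to a dyadic of the
  right denominator, so no bookkeeping of free intervals is needed.\<close>

locale requests =
  fixes act :: "nat \<Rightarrow> bool" and len :: "nat \<Rightarrow> nat" and out :: "nat \<Rightarrow> bool list"
  assumes computable_act: "computable act"
    and computable_len: "computable len"
    and computable_out: "computable out"
    and kraft: "\<And>n. (\<Sum>i<n. if act i then (1 / 2) ^ len i else (0 :: real)) \<le> 1"
begin

definition start :: "nat \<Rightarrow> real" where
  "start n = (\<Sum>i<n. if act i then (1 / 2) ^ len i else 0)"

text \<open>Numerator and binary exponent of \<open>start n\<close>, never reduced, so that the left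
  ends can be computed in the naturals.\<close>

definition dyadic_start :: "nat \<Rightarrow> nat \<times> nat" where
  "dyadic_start n = rec_nat (0, 0) (\<lambda>i p. if act i
     then (fst p * 2 ^ len i + 2 ^ snd p, snd p + len i) else p) n"

text \<open>The ceiling of \<open>start i * 2 ^ Suc (len i)\<close>.\<close>

definition pos :: "nat \<Rightarrow> nat" where
  "pos i = (fst (dyadic_start i) * 2 ^ Suc (len i) + 2 ^ snd (dyadic_start i) - 1)
     div 2 ^ snd (dyadic_start i)"

definition codes_for :: "nat \<Rightarrow> bool list \<Rightarrow> bool" where
  "codes_for i p \<longleftrightarrow> act i \<and> length p = Suc (len i) \<and> bval p = pos i"

definition machine_of :: machine where
  "machine_of p = (if \<exists>i. codes_for i p then Some (out (LEAST i. codes_for i p)) else None)"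

lemma start_dyadic: "start n = real (fst (dyadic_start n)) / 2 ^ snd (dyadic_start n)"
  by (induction n) (auto simp: start_def dyadic_start_def field_simps power_add)

lemma start_Suc: "start (Suc i) = start i + (if act i then (1 / 2) ^ len i else 0)"
  by (simp add: start_def)

lemma start_mono: "i \<le> j \<Longrightarrow> start i \<le> start j"
  unfolding start_def by (intro sum_mono2) auto

lemma pos_bounds:
  "start i * 2 ^ Suc (len i) \<le> real (pos i)" "real (pos i) < start i * 2 ^ Suc (len i) + 1"
  using ceiling_div_bounds[of "2 ^ snd (dyadic_start i)" "fst (dyadic_start i) * 2 ^ Suc (len i)"]
  unfolding pos_def[symmetric] by (simp_all add: start_dyadic)

text \<open>Measured in units of \<open>1 / 2 ^ Suc (len i)\<close>, rounding up shifts the left end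
  by less than one unit and the interval of the code is one unit long; the weight of the request is
  two units, so the code fits.\<close>

lemma codes_for_interval:
  assumes "codes_for i p"
  shows "start i \<le> real (bval (p @ r)) / 2 ^ length (p @ r)"
    "real (bval (p @ r)) / 2 ^ length (p @ r) < start (Suc i)"
proof -
  let ?k = "length r" and ?l = "Suc (len i)"
  have *: "act i" "length p = ?l" "bval p = pos i" using assms by (auto simp: codes_for_def)
  have "real (pos i * 2 ^ ?k) \<le> real (bval (p @ r))" "real (bval (p @ r)) < real ((pos i + 1) * 2 ^ ?k)"
    unfolding of_nat_le_iff of_nat_less_iff using bval_append[of p r] * by auto
  then have b: "real (pos i) * 2 ^ ?k \<le> real (bval (p @ r))"
    "real (bval (p @ r)) < (real (pos i) + 1) * 2 ^ ?k" by (simp_all add: algebra_simps)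
  have "start i * 2 ^ ?l * 2 ^ ?k \<le> real (bval (p @ r))"
    using b(1) pos_bounds(1)[of i] by (meson mult_right_mono order_trans zero_le_numeral zero_le_power)
  then show "start i \<le> real (bval (p @ r)) / 2 ^ length (p @ r)"
    using *(2) by (simp add: field_simps power_add)
  have "real (pos i) + 1 \<le> start i * 2 ^ ?l + 2" using pos_bounds(2)[of i] by simp
  also have "\<dots> = start (Suc i) * 2 ^ ?l" using *(1) by (simp add: start_Suc field_simps power_divide)
  finally have "real (bval (p @ r)) < start (Suc i) * 2 ^ ?l * 2 ^ ?k"
    using b(2) by (meson less_le_trans mult_right_mono zero_le_numeral zero_le_power)
  then show "real (bval (p @ r)) / 2 ^ length (p @ r) < start (Suc i)"
    using *(2) by (simp add: field_simps power_add)
qed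

text \<open>The point given by \<open>p @ r\<close> lies in the half-open intervals of both
  requests, and different requests have disjoint intervals. Empty \<open>r\<close> makes the machine
  well defined, general \<open>r\<close> makes it prefix-free.\<close>

lemma codes_for_unique:
  assumes "codes_for i p" "codes_for j (p @ r)" shows "i = j"
proof -
  note 1 = codes_for_interval[OF assms(1), of r] and 2 = codes_for_interval[OF assms(2), of "[]"]
  have "\<not> i < j" using 1 2 start_mono[of "Suc i" j] by (auto simp: Suc_le_eq)
  moreover have "\<not> j < i" using 1 2 start_mono[of "Suc j" i] by (auto simp: Suc_le_eq)
  ultimately show ?thesis by simp
qed

lemma machine_of_codes_for: "codes_for i p \<Longrightarrow> machine_of p = Some (out i)"
  unfolding machine_of_def
  using codes_for_unique[of _ p _ "[]"] by (auto intro!: arg_cong[of _ _ out] Least_equality)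

lemma machine_of_SomeE:
  assumes "machine_of p = Some \<sigma>"
  obtains i where "codes_for i p" "out i = \<sigma>"
  using assms machine_of_codes_for unfolding machine_of_def by (metis option.distinct(1) option.inject)

text \<open>The Kraft bound enters here: it keeps the interval inside the unit interval, so that
  \<open>pos i\<close> has a numeral of the required length.\<close>

lemma ex_codes_for:
  assumes "act i" obtains p where "codes_for i p" "length p = Suc (len i)"
proof -
  have "real (pos i) + 1 < start i * 2 ^ Suc (len i) + 2" using pos_bounds(2)[of i] by simp
  also have "\<dots> = start (Suc i) * 2 ^ Suc (len i)"
    using assms by (simp add: start_Suc field_simps power_divide)
  also have "\<dots> \<le> 1 * 2 ^ Suc (len i)"
    using kraft[of "Suc i"] unfolding start_def by (intro mult_right_mono) auto
  finally have "real (pos i) < real (2 ^ Suc (len i))" by simp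
  then have "pos i < 2 ^ Suc (len i)" by (simp only: of_nat_less_iff)
  then obtain p where "length p = Suc (len i)" "bval p = pos i" using ex_bval by blast
  then show ?thesis using that assms by (simp add: codes_for_def)
qed

lemma prefix_free_machine_of: "prefix_free_machine machine_of"
  unfolding prefix_free_machine_def
proof (intro conjI allI impI)
  fix p r assume "machine_of p \<noteq> None" "machine_of (p @ r) \<noteq> None"
  then obtain i j where ij: "codes_for i p" "codes_for j (p @ r)"
    by (auto elim!: machine_of_SomeE)
  then have "i = j" by (rule codes_for_unique)
  then show "r = []" using ij by (auto simp: codes_for_def)
next
  note [computable_intros] = computable_act[THEN computable_comp]
    computable_len[THEN computable_comp] computable_out[THEN computable_comp]
  have "computable dyadic_start" unfolding dyadic_start_def by (intro computable_intros)
  note [computable_intros] = this[THEN computable_comp]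
  have "computable pos" unfolding pos_def by (intro computable_intros)
  note [computable_intros] = this[THEN computable_comp]
  have "partial_computable (\<lambda>m. if \<exists>i. codes_for i (bl_of_nat m)
      then Some (nat_of_bl (out (LEAST i. codes_for i (bl_of_nat m)))) else None)"
    by (rule partial_computable_searchI[of "\<lambda>m i. codes_for i (bl_of_nat m)"
          "\<lambda>_ i. nat_of_bl (out i)"])
       (unfold codes_for_def, intro computable_intros, intro computable_intros)
  then show "computable_machine machine_of"
    unfolding computable_machine_def machine_of_def by (simp add: if_distrib[of "map_option _"] cong: if_cong)
qed

lemma Kc_machine_of_le: "act i \<Longrightarrow> Kc machine_of (out i) \<le> enat (Suc (len i))"
  by (metis Kc_le ex_codes_for machine_of_codes_for)

lemma Kc_machine_of_enatE:
  assumes "Kc machine_of \<sigma> = enat n"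
  obtains i where "act i" "out i = \<sigma>" "n = Suc (len i)"
proof -
  obtain p where "machine_of p = Some \<sigma>" "length p = n" using assms by (rule Kc_enatE)
  then show ?thesis using that by (auto elim!: machine_of_SomeE simp: codes_for_def)
qed

end

section \<open>An optimal machine\<close>

definition comparable :: "bool list \<Rightarrow> bool list \<Rightarrow> bool" where
  "comparable p q \<longleftrightarrow> take (length p) q = p \<or> take (length q) p = q"

lemma comparable_iff: "comparable p q \<longleftrightarrow> (\<exists>r. q = p @ r \<or> p = q @ r)"
  unfolding comparable_def by (metis append_eq_conv_conj append_take_drop_id)

text \<open>Split by the first bit: with that bit removed each half is an antichain of shorter
  strings, and the removal doubles its weight.\<close>

lemma kraft_antichain:
  assumes "finite F" "\<And>p q. p \<in> F \<Longrightarrow> q \<in> F \<Longrightarrow> comparable p q \<Longrightarrow> p = q"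
  shows "(\<Sum>p\<in>F. (1 / 2) ^ length p) \<le> (1 :: real)"
proof -
  obtain n where "\<forall>p\<in>F. length p \<le> n"
    using assms(1) by (meson finite_imageI finite_nat_set_iff_bounded_le imageI)
  then show ?thesis using assms
  proof (induction n arbitrary: F)
    case 0
    then have "F \<subseteq> {[]}" by auto
    then have "F = {} \<or> F = {[]}" by auto
    then show ?case by auto
  next
    case (Suc n)
    show ?case
    proof (cases "[] \<in> F")
      case True
      have "comparable [] p" for p by (simp add: comparable_def)
      then have "F = {[]}" using Suc.prems(3)[OF True] True by blast
      then show ?thesis by simp
    next
      case False
      define G where "G b = {p. b # p \<in> F}" for b
      have fin: "finite (G b)" for b
        using Suc.prems(2) unfolding G_def by (rule finite_vimageI[of _ "(#) b", unfolded vimage_def]) simp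
      have F: "F = (#) True ` G True \<union> (#) False ` G False"
      proof (intro set_eqI iffI)
        fix p assume p: "p \<in> F"
        then obtain b p' where "p = b # p'" using False by (cases p) auto
        then show "p \<in> (#) True ` G True \<union> (#) False ` G False"
          using p by (cases b) (auto simp: G_def)
      qed (auto simp: G_def)
      have le: "(\<Sum>p\<in>G b. (1 / 2) ^ length p) \<le> (1 :: real)" for b
      proof (rule Suc.IH)
        show "\<forall>p\<in>G b. length p \<le> n" using Suc.prems(1) by (auto simp: G_def)
        show "p = q" if "p \<in> G b" "q \<in> G b" "comparable p q" for p q
          using Suc.prems(3)[of "b # p" "b # q"] that by (auto simp: G_def comparable_def)
      qed (rule fin)
      have "(\<Sum>p\<in>F. (1 / 2) ^ length p) = (\<Sum>p\<in>(#) True ` G True. (1 / 2) ^ length p)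
          + (\<Sum>p\<in>(#) False ` G False. (1 / 2 :: real) ^ length p)"
        by (subst F, rule sum.union_disjoint) (auto intro: fin)
      also have "\<dots> = (\<Sum>p\<in>G True. (1 / 2) ^ length p) / 2 + (\<Sum>p\<in>G False. (1 / 2) ^ length p) / 2"
        by (simp add: sum.reindex sum_divide_distrib)
      also have "\<dots> \<le> 1" using le[of True] le[of False] by simp
      finally show ?thesis .
    qed
  qed
qed

text \<open>Stage \<open>s\<close> of the universal enumeration is a quadruple of a term code, an input,
  an output and a certificate.\<close>

type_synonym stage = "nat \<times> nat \<times> nat \<times> fact list"

definition stage_code :: "nat \<Rightarrow> nat" where
  "stage_code s = fst (dec s :: stage)"

definition stage_input :: "nat \<Rightarrow> bool list" where
  "stage_input s = bl_of_nat (fst (snd (dec s :: stage)))"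

definition stage_output :: "nat \<Rightarrow> bool list" where
  "stage_output s = bl_of_nat (fst (snd (snd (dec s :: stage))))"

definition stage_ok :: "nat \<Rightarrow> bool" where
  "stage_ok s \<longleftrightarrow> cert (snd (snd (snd (dec s :: stage)))) \<and>
     (stage_code s, [nat_of_bl (stage_input s)], nat_of_bl (stage_output s))
       \<in> set (snd (snd (snd (dec s :: stage))))"

text \<open>Forces the accepted inputs of every code to be pairwise incomparable, whatever the term
  does. For a term that computes a prefix-free machine only repetitions of an input are
  lost.\<close>

definition uact :: "nat \<Rightarrow> bool" where
  "uact s \<longleftrightarrow> stage_ok s \<and> \<not> (\<exists>r<s. stage_ok r \<and> stage_code r = stage_code s \<and>
     comparable (stage_input r) (stage_input s))"

text \<open>The surcharge gives code \<open>e\<close> the share 2^-(e+1) of the total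
  weight.\<close>

definition ulen :: "nat \<Rightarrow> nat" where
  "ulen s = length (stage_input s) + Suc (stage_code s)"

lemma computable_stage [computable_intros]:
  assumes "computable f"
  shows "computable (\<lambda>x. stage_code (f x))" "computable (\<lambda>x. stage_input (f x))"
    "computable (\<lambda>x. stage_output (f x))" "computable (\<lambda>x. stage_ok (f x))"
proof -
  show "computable (\<lambda>x. stage_code (f x))" unfolding stage_code_def by (intro computable_intros assms)
  show "computable (\<lambda>x. stage_input (f x))" unfolding stage_input_def by (intro computable_intros assms)
  show "computable (\<lambda>x. stage_output (f x))" unfolding stage_output_def by (intro computable_intros assms)
  show "computable (\<lambda>x. stage_ok (f x))"
    unfolding stage_ok_def stage_code_def stage_input_def stage_output_def
    by (intro computable_intros assms)
qed

lemma computable_uact [computable_intros]: "computable f \<Longrightarrow> computable (\<lambda>x. uact (f x))"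
  by (rule computable_comp[of uact])
     (unfold uact_def comparable_def, intro computable_intros)

lemma computable_ulen [computable_intros]: "computable f \<Longrightarrow> computable (\<lambda>x. ulen (f x))"
  unfolding ulen_def by (intro computable_intros)

lemma sum_half_powers_le: "finite E \<Longrightarrow> (\<Sum>e\<in>E. (1 / 2) ^ Suc e) \<le> (1 :: real)"
  using sum_le_suminf[of "\<lambda>e. (1 / 2 :: real) ^ Suc e" E] power_half_series
  by (auto simp: sums_iff)

text \<open>Grouped by code, the accepted inputs form antichains, which weigh at most 1 each before
  the surcharge.\<close>

lemma kraft_universal: "(\<Sum>s<n. if uact s then (1 / 2) ^ ulen s else 0) \<le> (1 :: real)"
proof -
  let ?S = "{s. s < n \<and> uact s}"
  have "(\<Sum>s<n. if uact s then (1 / 2) ^ ulen s else 0) = (\<Sum>s\<in>?S. (1 / 2 :: real) ^ ulen s)"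
    by (simp add: sum.If_cases Int_def)
  also have "\<dots> = (\<Sum>e\<in>stage_code ` ?S. \<Sum>s\<in>{s \<in> ?S. stage_code s = e}. (1 / 2) ^ ulen s)"
    by (rule sum.image_gen) simp
  also have "\<dots> \<le> (\<Sum>e\<in>stage_code ` ?S. (1 / 2) ^ Suc e)"
  proof (rule sum_mono)
    fix e
    let ?T = "{s \<in> ?S. stage_code s = e}"
    have inc: "s = t" if st: "s \<in> ?T" "t \<in> ?T" "comparable (stage_input s) (stage_input t)" for s t
    proof -
      have "comparable (stage_input t) (stage_input s)"
        using st(3) by (auto simp: comparable_def)
      then have "\<not> t < s" "\<not> s < t" using st by (auto simp: uact_def)
      then show "s = t" by simp
    qed
    have inj: "inj_on stage_input ?T"
    proof (rule inj_onI)
      show "s = t" if "s \<in> ?T" "t \<in> ?T" "stage_input s = stage_input t" for s t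
        using that(1,2) by (rule inc) (simp add: that(3) comparable_def)
    qed
    have "(\<Sum>s\<in>?T. (1 / 2) ^ ulen s) = (\<Sum>s\<in>?T. (1 / 2 :: real) ^ length (stage_input s)) * (1 / 2) ^ Suc e"
      unfolding sum_distrib_right by (rule sum.cong) (auto simp: ulen_def power_add)
    also have "(\<Sum>s\<in>?T. (1 / 2 :: real) ^ length (stage_input s))
        = (\<Sum>p\<in>stage_input ` ?T. (1 / 2) ^ length p)"
      by (rule sum.reindex[OF inj, of "\<lambda>p. (1 / 2 :: real) ^ length p", unfolded o_def, symmetric])
    also have "(\<Sum>p\<in>stage_input ` ?T. (1 / 2) ^ length p) * (1 / 2 :: real) ^ Suc e \<le> 1 * (1 / 2) ^ Suc e"
    proof (intro mult_right_mono kraft_antichain)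
      show "p = q" if "p \<in> stage_input ` ?T" "q \<in> stage_input ` ?T" "comparable p q" for p q
        using that inc by blast
    qed auto
    finally show "(\<Sum>s\<in>?T. (1 / 2) ^ ulen s) \<le> (1 / 2 :: real) ^ Suc e" by simp
  qed
  also have "\<dots> \<le> 1" by (rule sum_half_powers_le) simp
  finally show ?thesis .
qed

text \<open>Each description of this machine belongs to an accepted stage \<open>s\<close> and has
  length \<open>Suc (ulen s)\<close>, so the cost function can be computed from stages
  alone.\<close>

global_interpretation universal: requests uact ulen stage_output
  defines universal_machine = universal.machine_of
  by unfold_locales (intro computable_intros kraft_universal)+

lemma optimal_universal_machine: "optimal_machine universal_machine"
  unfolding optimal_machine_def
proof (intro conjI allI impI)
  show "prefix_free_machine universal_machine" by (rule universal.prefix_free_machine_of)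
next
  fix N assume N: "prefix_free_machine N"
  then obtain t where t: "\<And>m y. reval t [m] y \<longleftrightarrow> map_option nat_of_bl (N (bl_of_nat m)) = Some y"
    unfolding prefix_free_machine_def computable_machine_def partial_computable_def by blast
  have ok: "N (stage_input s) = Some (stage_output s)" if "stage_ok s" "stage_code s = code t" for s
  proof -
    have "reval t [nat_of_bl (stage_input s)] (nat_of_bl (stage_output s))"
      using that cert_sound unfolding stage_ok_def by metis
    then show ?thesis unfolding t by (auto dest: arg_cong[of _ _ bl_of_nat])
  qed
  \<comment> \<open>Of the constant, \<open>Suc (code t)\<close> is the surcharge in
    \<open>ulen\<close> and the remaining 1 is the extra bit of the request machine.\<close>
  have "Kc universal_machine \<sigma> \<le> Kc N \<sigma> + enat (code t + 2)" for \<sigma>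
  proof (cases "Kc N \<sigma>")
    case (enat k)
    then obtain p where p: "N p = Some \<sigma>" "length p = k" by (rule Kc_enatE)
    define P where "P s \<longleftrightarrow> stage_ok s \<and> stage_code s = code t \<and> stage_input s = p" for s
    have "reval t [nat_of_bl p] (nat_of_bl \<sigma>)" unfolding t using p by simp
    then obtain C where C: "cert C" "(code t, [nat_of_bl p], nat_of_bl \<sigma>) \<in> set C"
      unfolding reval_iff_cert by blast
    have "P (enc (code t, nat_of_bl p, nat_of_bl \<sigma>, C))"
      using C unfolding P_def stage_ok_def stage_code_def stage_input_def stage_output_def
      by (simp add: dec_enc del: enc_prod_def)
    then have "P (LEAST s. P s)" by (rule LeastI)
    then obtain s where s: "P s" and least: "\<And>r. r < s \<Longrightarrow> \<not> P r"
      by (rule that) (rule not_less_Least)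
    have "uact s"
      unfolding uact_def
    proof (intro conjI notI)
      assume "\<exists>r<s. stage_ok r \<and> stage_code r = stage_code s \<and>
        comparable (stage_input r) (stage_input s)"
      then obtain r where r: "r < s" "stage_ok r" "stage_code r = code t" "comparable (stage_input r) p"
        using s unfolding P_def by auto
      \<comment> \<open>A prefix-free \<open>N\<close> is not defined on two distinct comparable
        inputs, so the rival stage has input \<open>p\<close> as well, against the minimality of
        \<open>s\<close>.\<close>
      have "N (stage_input r) \<noteq> None" using ok[OF r(2,3)] by simp
      then have "stage_input r = p"
        using r(4) N p(1) unfolding comparable_iff prefix_free_machine_def by auto
      then show False using r least[of r] unfolding P_def by auto
    qed (use s in \<open>simp add: P_def\<close>)
    moreover have "stage_output s = \<sigma>" "ulen s = k + Suc (code t)"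
      using s ok[of s] p unfolding P_def by (auto simp: ulen_def)
    ultimately have "Kc universal_machine \<sigma> \<le> enat (Suc (k + Suc (code t)))"
      using universal.Kc_machine_of_le[of s] by simp
    then show ?thesis using enat by simp
  qed simp
  then show "\<exists>c. \<forall>\<sigma>. Kc universal_machine \<sigma> \<le> Kc N \<sigma> + enat c" by blast
qed

section \<open>A noncomputable set of low cost\<close>

lemma enc_tuple_zeros: "enc_tuple (replicate n 0) = replicate n False"
  by (induction n) (auto simp: enc_tuple_def)

lemma computable_enc_tuple [computable_intros]:
  "computable f \<Longrightarrow> computable (\<lambda>x. enc_tuple (f x))"
  unfolding enc_tuple_def by (intro computable_intros)

section \<open>The cost function\<close>

definition zlen :: "nat \<Rightarrow> nat" where
  "zlen t = length (stage_output t)"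

definition zero_request :: "nat \<Rightarrow> bool" where
  "zero_request t \<longleftrightarrow> uact t \<and> stage_output t = replicate (zlen t) False"

text \<open>The weight of the descriptions of strings \<open>0\<^sup>n\<close> with \<open>n > x\<close> that have appeared before
  stage \<open>s\<close>: the price of changing the set at \<open>x\<close> at stage \<open>s\<close>.\<close>

definition cost :: "nat \<Rightarrow> nat \<Rightarrow> real" where
  "cost x s = (\<Sum>t<s. if zero_request t \<and> x < zlen t then (1 / 2) ^ ulen t else 0)"

definition affordable :: "nat \<Rightarrow> nat \<Rightarrow> nat \<Rightarrow> bool" where
  "affordable e x s \<longleftrightarrow> cost x s \<le> (1 / 2) ^ Suc e"

lemma computable_zlen [computable_intros]: "computable f \<Longrightarrow> computable (\<lambda>x. zlen (f x))"
  unfolding zlen_def by (intro computable_intros)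

lemma computable_zero_request [computable_intros]:
  "computable f \<Longrightarrow> computable (\<lambda>x. zero_request (f x))"
  unfolding zero_request_def by (intro computable_intros)

text \<open>Multiplication by \<open>2 ^ (\<Sum>t<s. ulen t)\<close>, a common denominator of all
  the weights, leaves a decidable inequality between naturals.\<close>

lemma cost_le_iff:
  "cost x s \<le> (1 / 2) ^ Suc e \<longleftrightarrow>
   (\<Sum>t<s. if zero_request t \<and> x < zlen t then 2 ^ ((\<Sum>t<s. ulen t) - ulen t) else 0) * 2 ^ Suc e
     \<le> (2 ^ (\<Sum>t<s. ulen t) :: nat)"
proof -
  define D where "D = (\<Sum>t<s. ulen t)"
  define N where "N = (\<Sum>t<s. if zero_request t \<and> x < zlen t then 2 ^ (D - ulen t) else 0 :: nat)"
  have le: "ulen t \<le> D" if "t < s" for t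
    unfolding D_def using that by (intro member_le_sum) auto
  have "real N = (\<Sum>t<s. if zero_request t \<and> x < zlen t then 2 ^ (D - ulen t) else 0)"
    unfolding N_def of_nat_sum by (rule sum.cong) auto
  also have "\<dots> = cost x s * 2 ^ D"
    unfolding cost_def sum_distrib_right
    by (rule sum.cong) (auto simp: le power_diff power_one_over)
  finally have cost: "cost x s = real N / 2 ^ D" by simp
  have "a / p \<le> (1 / 2) ^ k \<longleftrightarrow> a * 2 ^ k \<le> p" if "p > 0" for a p :: real and k :: nat
    using that by (simp add: power_one_over field_simps)
  then have "cost x s \<le> (1 / 2) ^ Suc e \<longleftrightarrow> real (N * 2 ^ Suc e) \<le> real (2 ^ D)"
    unfolding cost by (simp add: mult.assoc)
  then show ?thesis unfolding of_nat_le_iff N_def D_def .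
qed

lemma computable_affordable [computable_intros]:
  assumes "computable f" "computable g" "computable h"
  shows "computable (\<lambda>x. affordable (f x) (g x) (h x))"
  unfolding affordable_def cost_le_iff
  by (intro computable_intros assms assms[THEN computable_comp])

lemma zero_weight_le: "(\<Sum>t<n. if zero_request t then (1 / 2) ^ ulen t else 0) \<le> (1 :: real)"
proof -
  have "(\<Sum>t<n. if zero_request t then (1 / 2) ^ ulen t else 0)
      \<le> (\<Sum>t<n. if uact t then (1 / 2) ^ ulen t else (0 :: real))"
    by (rule sum_mono) (auto simp: zero_request_def)
  then show ?thesis using kraft_universal[of n] by simp
qed

text \<open>The weights form a convergent series. If \<open>x\<close> exceeds the lengths of the
  first \<open>m\<close> outputs, then only the tail from \<open>m\<close> on contributes to the
  cost, at every stage.\<close>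

lemma eventually_affordable: "\<exists>x0. \<forall>x\<ge>x0. \<forall>s. affordable e x s"
proof -
  define w where "w t = (if zero_request t then (1 / 2) ^ ulen t else (0 :: real))" for t
  have w0: "0 \<le> w t" for t by (simp add: w_def)
  have "summable w"
    using w0 zero_weight_le unfolding w_def[symmetric] by (intro summableI_nonneg_bounded) auto
  then have "(\<lambda>m. \<Sum>t. w (t + m)) \<longlonglongrightarrow> 0" by (rule suminf_exist_split2)
  then have "\<forall>\<^sub>F m in sequentially. (\<Sum>t. w (t + m)) < (1 / 2) ^ Suc e"
    by (rule order_tendstoD) simp
  then obtain m where m: "(\<Sum>t. w (t + m)) < (1 / 2) ^ Suc e"
    unfolding eventually_sequentially by blast
  show ?thesis
  \<comment> \<open>The sum serves as a bound on each of the first \<open>m\<close> lengths.\<close>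
  proof (intro exI[of _ "\<Sum>t<m. zlen t"] allI impI)
    fix x s assume x: "(\<Sum>t<m. zlen t) \<le> x"
    have big: "m \<le> t" if "x < zlen t" for t
    proof (rule ccontr)
      assume "\<not> m \<le> t"
      then have "zlen t \<le> (\<Sum>t<m. zlen t)" by (intro member_le_sum) auto
      then show False using that x by simp
    qed
    have "cost x s = (\<Sum>t\<in>{t. t < s \<and> zero_request t \<and> x < zlen t}. w t)"
      unfolding cost_def w_def by (simp add: sum.If_cases Int_def)
    also have "\<dots> \<le> (\<Sum>t\<in>{m..<s + m}. w t)"
      by (rule sum_mono2) (auto simp: w0 big trans_less_add1)
    also have "\<dots> = (\<Sum>t<s. w (t + m))"
      using sum.shift_bounds_nat_ivl[of w 0 m s] by (simp add: atLeast0LessThan)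
    also have "\<dots> \<le> (\<Sum>t. w (t + m))"
      using \<open>summable w\<close> w0 by (intro sum_le_suminf) (auto simp: summable_iff_shift)
    finally show "affordable e x s" using m by (simp add: affordable_def)
  qed
qed

text \<open>Stage \<open>s\<close> of the construction is a triple of a term code \<open>e\<close>, an index \<open>i\<close> into row \<open>e\<close> and
  a certificate.\<close>

type_synonym row_stage = "nat \<times> nat \<times> fact list"

definition row :: "nat \<Rightarrow> nat" where
  "row s = fst (dec s :: row_stage)"

text \<open>Pairing with the row makes the rows disjoint, and the element is at least its index, so
  each row has arbitrarily large elements.\<close>

definition elem :: "nat \<Rightarrow> nat" where
  "elem s = prod_encode (row s, fst (snd (dec s :: row_stage)))"

definition candidate :: "nat \<Rightarrow> bool" where
  "candidate s \<longleftrightarrow> cert (snd (snd (dec s :: row_stage))) \<and>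
     (row s, [elem s], 0) \<in> set (snd (snd (dec s :: row_stage))) \<and> affordable (row s) (elem s) s"

definition acts :: "nat \<Rightarrow> bool" where
  "acts s \<longleftrightarrow> candidate s \<and> \<not> (\<exists>r<s. candidate r \<and> row r = row s)"

definition low_set :: "nat \<Rightarrow> bool" where
  "low_set x \<longleftrightarrow> (\<exists>s. acts s \<and> elem s = x)"

text \<open>Stage \<open>s\<close> is included, so a description renewed at stage \<open>s\<close>
  already records the change made there.\<close>

definition low_set_upto :: "nat \<Rightarrow> nat \<Rightarrow> bool" where
  "low_set_upto s x \<longleftrightarrow> (\<exists>r<Suc s. acts r \<and> elem r = x)"

lemma computable_row [computable_intros]: "computable f \<Longrightarrow> computable (\<lambda>x. row (f x))"
  unfolding row_def by (intro computable_intros)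

lemma computable_elem [computable_intros]: "computable f \<Longrightarrow> computable (\<lambda>x. elem (f x))"
  unfolding elem_def by (intro computable_intros)

lemma computable_candidate [computable_intros]:
  "computable f \<Longrightarrow> computable (\<lambda>x. candidate (f x))"
  unfolding candidate_def by (intro computable_intros)

lemma computable_acts [computable_intros]: "computable f \<Longrightarrow> computable (\<lambda>x. acts (f x))"
  by (rule computable_comp[of acts]) (unfold acts_def, intro computable_intros)

lemma computable_low_set_upto [computable_intros]:
  assumes "computable f" "computable g" shows "computable (\<lambda>x. low_set_upto (f x) (g x))"
  unfolding low_set_upto_def by (intro computable_intros assms assms[THEN computable_comp])

lemma acts_unique: "acts r \<Longrightarrow> acts s \<Longrightarrow> row r = row s \<Longrightarrow> r = s"
  unfolding acts_def by (metis linorder_neqE_nat)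

lemma row_elem: "row s = fst (prod_decode (elem s))"
  by (simp add: elem_def)

text \<open>An element enters row \<open>code t\<close> only after \<open>t\<close> has been seen to
  answer 0 on it, so a term \<open>t\<close> for the set is refuted as soon as its row is
  nonempty.\<close>

lemma low_set_not_computable: "\<not> computable low_set"
proof
  assume "computable low_set"
  then obtain g where g: "computable_fun g" "\<And>x. g (enc x) = enc (low_set x)"
    unfolding computable_def by blast
  then obtain t where t: "\<And>x y. reval t [x] y \<longleftrightarrow> of_bool (low_set x) = y"
    unfolding computable_fun_def partial_computable_def by auto
  obtain x0 where x0: "\<And>x s. x0 \<le> x \<Longrightarrow> affordable (code t) x s"
    using eventually_affordable by blast
  have "\<exists>s. candidate s \<and> row s = code t"
  proof (rule ccontr)
    assume none: "\<nexists>s. candidate s \<and> row s = code t"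
    \<comment> \<open>If nothing enters the row, then \<open>t\<close> answers 0 throughout it, in
      particular on this \<open>x\<close>, which is affordable at every stage and so becomes a
      candidate.\<close>
    define x where "x = prod_encode (code t, x0)"
    have "\<not> low_set x"
      using none unfolding low_set_def acts_def x_def by (auto simp: row_elem)
    then have "reval t [x] 0" unfolding t by simp
    then obtain C where C: "cert C" "(code t, [x], 0) \<in> set C" unfolding reval_iff_cert by blast
    define s where "s = enc (code t, x0, C)"
    have s: "dec s = (code t, x0, C)" unfolding s_def by (rule dec_enc)
    then have "row s = code t" "elem s = x" by (simp_all add: row_def elem_def x_def)
    moreover have "affordable (code t) x s"
      by (rule x0) (simp add: x_def le_prod_encode_2)
    ultimately have "candidate s" using C s unfolding candidate_def by simp
    then show False using none \<open>row s = code t\<close> by blast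
  qed
  then have "\<exists>s. (candidate s \<and> row s = code t) \<and> (\<forall>r<s. \<not> (candidate r \<and> row r = code t))"
    by (rule exists_least_iff[THEN iffD1])
  then obtain s where s: "candidate s" "row s = code t" "\<forall>r<s. \<not> (candidate r \<and> row r = code t)"
    by blast
  then have "acts s" by (simp add: acts_def)
  then have "low_set (elem s)" unfolding low_set_def by blast
  moreover have "reval t [elem s] 0"
    using s(1,2) cert_sound unfolding candidate_def by metis
  ultimately show False unfolding t by simp
qed

section \<open>K-triviality\<close>

text \<open>A request is coded by a pair \<open>(s, t)\<close>. If \<open>s = t\<close>, the description of \<open>0\<^sup>n\<close> found at stage \<open>t\<close> is
  copied; if \<open>t < s\<close>, the copy is renewed because the set changes below \<open>n\<close> at stage \<open>s\<close>.\<close>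

locale low_set_functional =
  fixes \<Gamma> :: "bool list \<Rightarrow> nat list" and \<alpha> :: "nat \<Rightarrow> nat"
  assumes computable_functional: "computable \<Gamma>"
    and restr_eq: "\<And>n. restr \<alpha> n = \<Gamma> (map low_set [0..<n])"
begin

definition new :: "nat \<Rightarrow> nat" where "new v = fst (dec v :: nat \<times> nat)"
definition old :: "nat \<Rightarrow> nat" where "old v = snd (dec v :: nat \<times> nat)"

definition vact :: "nat \<Rightarrow> bool" where
  "vact v \<longleftrightarrow> zero_request (old v) \<and>
     (new v = old v \<or> old v < new v \<and> acts (new v) \<and> elem (new v) < zlen (old v))"

text \<open>The extra bit halves all weights: first copies and renewals then take at most 1/2
  each.\<close>

definition vlen :: "nat \<Rightarrow> nat" where
  "vlen v = Suc (ulen (old v))"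

definition vout :: "nat \<Rightarrow> bool list" where
  "vout v = enc_tuple (\<Gamma> (map (low_set_upto (new v)) [0..<zlen (old v)]))"

lemma sum_acting: "(\<Sum>s | s < n \<and> acts s. cost (elem s) s) \<le> 1"
proof -
  let ?A = "{s. s < n \<and> acts s}"
  have inj: "inj_on row ?A" by (rule inj_onI) (auto intro: acts_unique)
  have "(\<Sum>s\<in>?A. cost (elem s) s) \<le> (\<Sum>s\<in>?A. (1 / 2) ^ Suc (row s))"
    by (rule sum_mono) (auto simp: acts_def candidate_def affordable_def)
  also have "\<dots> = (\<Sum>e\<in>row ` ?A. (1 / 2) ^ Suc e)"
    by (rule sum.reindex[OF inj, of "\<lambda>e. (1 / 2 :: real) ^ Suc e", unfolded o_def, symmetric])
  also have "\<dots> \<le> 1" by (rule sum_half_powers_le) simp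
  finally show ?thesis .
qed

text \<open>Active pairs are split into the diagonal, whose weight is half that of the descriptions
  of zeros, and for each acting stage \<open>s\<close> the pairs renewed there, whose weight is at
  most half of \<open>cost (elem s) s\<close>.\<close>

lemma kraft_trivial: "(\<Sum>v<n. if vact v then (1 / 2) ^ vlen v else 0) \<le> (1 :: real)"
proof -
  let ?V = "{v. v < n \<and> vact v}" and ?Z = "{t. t < n \<and> zero_request t}"
    and ?A = "{s. s < n \<and> acts s}" and ?T = "\<lambda>s. {t. t < s \<and> zero_request t \<and> elem s < zlen t}"
    and ?w = "\<lambda>t. (1 / 2 :: real) ^ Suc (ulen t)"
  have inj: "inj_on (dec :: nat \<Rightarrow> nat \<times> nat) ?V"
    by (rule inj_onI) (metis enc_dec)
  \<comment> \<open>A code dominates its components, so the codes below \<open>n\<close> stay within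
    the finite sets \<open>?Z\<close> and \<open>?A\<close>.\<close>
  have bound: "new v \<le> v" "old v \<le> v" for v
  proof -
    have "prod_encode (new v, old v) = v"
      using enc_dec[of v, where 'a = "nat \<times> nat"] by (simp add: new_def old_def)
    then show "new v \<le> v" "old v \<le> v"
      using le_prod_encode_1[of "new v" "old v"] le_prod_encode_2[of "old v" "new v"] by simp_all
  qed
  have sub: "(dec ` ?V :: (nat \<times> nat) set) \<subseteq> (\<lambda>t. (t, t)) ` ?Z \<union> Sigma ?A ?T"
  proof
    fix p assume "p \<in> (dec ` ?V :: (nat \<times> nat) set)"
    then obtain v where v: "p = dec v" "v < n" "vact v" by blast
    then have p: "p = (new v, old v)" by (simp add: new_def old_def)
    have "new v < n" "old v < n" using bound[of v] v(2) by linarith+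
    then show "p \<in> (\<lambda>t. (t, t)) ` ?Z \<union> Sigma ?A ?T"
      using v(3) unfolding vact_def p by auto
  qed
  have "(\<Sum>v<n. if vact v then (1 / 2) ^ vlen v else 0) = (\<Sum>v\<in>?V. ?w (snd (dec v :: nat \<times> nat)))"
    by (simp add: sum.If_cases Int_def vlen_def old_def)
  also have "\<dots> = (\<Sum>p\<in>(dec ` ?V :: (nat \<times> nat) set). ?w (snd p))"
    by (rule sum.reindex[OF inj, of "\<lambda>p. ?w (snd p)", unfolded o_def, symmetric])
  also have "\<dots> \<le> (\<Sum>p\<in>(\<lambda>t. (t, t)) ` ?Z \<union> Sigma ?A ?T. ?w (snd p))"
    by (rule sum_mono2[OF _ sub]) auto
  also have "\<dots> = (\<Sum>p\<in>(\<lambda>t. (t, t)) ` ?Z. ?w (snd p)) + (\<Sum>p\<in>Sigma ?A ?T. ?w (snd p))"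
    by (rule sum.union_disjoint) auto
  also have "(\<Sum>p\<in>(\<lambda>t. (t, t)) ` ?Z. ?w (snd p)) = (\<Sum>t\<in>?Z. ?w t)"
    by (subst sum.reindex) (auto simp: inj_on_def)
  also have "(\<Sum>t\<in>?Z. ?w t) = (\<Sum>t<n. if zero_request t then (1 / 2) ^ ulen t else 0) / 2"
    by (simp add: sum.If_cases Int_def sum_divide_distrib)
  also have "(\<Sum>p\<in>Sigma ?A ?T. ?w (snd p)) = (\<Sum>s\<in>?A. \<Sum>t\<in>?T s. ?w t)"
    by (subst sum.Sigma) (auto simp: case_prod_beta)
  also have "\<dots> = (\<Sum>s\<in>?A. cost (elem s) s / 2)"
    by (rule sum.cong) (auto simp: cost_def sum.If_cases Int_def sum_divide_distrib)
  also have "\<dots> = (\<Sum>s\<in>?A. cost (elem s) s) / 2" by (simp add: sum_divide_distrib)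
  finally show ?thesis using zero_weight_le[of n] sum_acting[of n] by simp
qed

lemma requests_trivial: "requests vact vlen vout"
proof
  note [computable_intros] = computable_functional[THEN computable_comp]
  show "computable vact" unfolding vact_def new_def old_def by (intro computable_intros)
  show "computable vlen" unfolding vlen_def old_def by (intro computable_intros)
  show "computable vout" unfolding vout_def new_def old_def by (intro computable_intros)
qed (rule kraft_trivial)

text \<open>Elements of acting stages are distinct, so only finitely many stages after
  \<open>t\<close> change the set below \<open>n\<close>. The renewal at the last of them sees the
  final values.\<close>

lemma ex_request:
  assumes "zero_request t" obtains v where "vact v" "old v = t" "vout v = enc_tuple (restr \<alpha> (zlen t))"
proof -
  define n where "n = zlen t"
  define S where "S = {s. t < s \<and> acts s \<and> elem s < n}"
  have "inj_on elem S"
    by (rule inj_onI) (auto simp: S_def row_elem intro: acts_unique)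
  moreover have "finite (elem ` S)" by (rule finite_subset[of _ "{..<n}"]) (auto simp: S_def)
  ultimately have fin: "finite S" by (rule finite_imageD[rotated])
  \<comment> \<open>Inserting \<open>t\<close> covers the case of no later change, where the first
    copy is already correct.\<close>
  define s where "s = Max (insert t S)"
  have s: "s \<in> insert t S" "\<And>r. r \<in> insert t S \<Longrightarrow> r \<le> s"
    unfolding s_def using fin Max_in[of "insert t S"] Max_ge[of "insert t S"] by blast+
  have "low_set_upto s x \<longleftrightarrow> low_set x" if "x < n" for x
  proof -
    have "r < Suc s" if "acts r" "elem r = x" for r
      using s(2)[of r] s(2)[of t] that \<open>x < n\<close> by (cases "t < r") (auto simp: S_def)
    then show ?thesis unfolding low_set_upto_def low_set_def by blast
  qed
  then have eq: "map (low_set_upto s) [0..<n] = map low_set [0..<n]" by simp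
  define v where "v = enc (s, t)"
  have v: "new v = s" "old v = t" unfolding new_def old_def v_def dec_enc by simp_all
  have "vact v" unfolding vact_def v using assms s(1) by (auto simp: S_def n_def)
  moreover have "vout v = enc_tuple (restr \<alpha> n)" unfolding vout_def v restr_eq n_def[symmetric] eq ..
  ultimately show ?thesis using that v(2) n_def by blast
qed

lemma K_trivial: "K_trivial_fun \<alpha>"
proof -
  interpret V: requests vact vlen vout by (rule requests_trivial)
  obtain c where c: "\<And>\<sigma>. Kc universal_machine \<sigma> \<le> Kc V.machine_of \<sigma> + enat c"
    using optimal_universal_machine V.prefix_free_machine_of unfolding optimal_machine_def by blast
  \<comment> \<open>The 1 in \<open>Suc c\<close> is the extra bit in \<open>vlen\<close>; the extra
    bit of the request machine occurs in both lengths and cancels.\<close>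
  have "Kc universal_machine (enc_tuple (restr \<alpha> n))
      \<le> Kc universal_machine (enc_tuple (replicate n 0)) + enat (Suc c)" for n
  proof (cases "Kc universal_machine (enc_tuple (replicate n 0))")
    case (enat k)
    then obtain t where t: "uact t" "stage_output t = replicate n False" "k = Suc (ulen t)"
      unfolding enc_tuple_zeros by (rule universal.Kc_machine_of_enatE)
    then have "zero_request t" "zlen t = n" by (simp_all add: zero_request_def zlen_def)
    then obtain v where v: "vact v" "old v = t" "vout v = enc_tuple (restr \<alpha> n)"
      using ex_request by metis
    have "Kc universal_machine (enc_tuple (restr \<alpha> n)) \<le> Kc V.machine_of (vout v) + enat c"
      using c v(3) by simp
    also have "\<dots> \<le> enat (Suc (vlen v)) + enat c"
      by (intro add_right_mono V.Kc_machine_of_le v(1))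
    finally show ?thesis using t(3) v(2) enat by (simp add: vlen_def)
  qed simp
  then show ?thesis using optimal_universal_machine unfolding K_trivial_fun_def by blast
qed

end

section \<open>A computable Cantor scheme\<close>

lemma computable_fun3_comp:
  assumes f: "computable_fun3 f" and "computable a" "computable b" "computable c"
  shows "computable (\<lambda>x. f (a x) (b x) (c x))"
proof -
  obtain t where "\<And>i k n y. reval t [i, k, n] y \<longleftrightarrow> f i k n = y"
    using f unfolding computable_fun3_def by blast
  then have "computes 3 t (\<lambda>xs. f (xs ! 0) (xs ! 1) (xs ! 2))"
    unfolding computes_def by (auto simp: eval_nat_numeral length_Suc_conv)
  then have f3: "recursive 3 (\<lambda>xs. f (xs ! 0) (xs ! 1) (xs ! 2))"
    unfolding recursive_def by blast
  have g: "recursive 1 (\<lambda>xs. g (xs ! 0))" if "computable g" for g :: "nat \<Rightarrow> nat"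
    using that unfolding recursive_1_iff computable_nat_iff .
  have "recursive 1 (\<lambda>xs. fst (prod_decode (xs ! 0)))"
    "recursive 1 (\<lambda>xs. fst (prod_decode (snd (prod_decode (xs ! 0)))))"
    "recursive 1 (\<lambda>xs. snd (prod_decode (snd (prod_decode (xs ! 0)))))"
    by (rule g, intro computable_intros)+
  note * = recursive_comp3[OF f3 this]
  let ?g = "\<lambda>z. f (fst (prod_decode z)) (fst (prod_decode (snd (prod_decode z))))
      (snd (prod_decode (snd (prod_decode z))))"
  have "recursive 1 (\<lambda>xs. ?g (xs ! 0))"
    by (rule recursive_cong[OF *]) (simp add: numeral_2_eq_2)
  then have "computable_fun ?g" by (rule iffD1[OF recursive_1_iff[of ?g]])
  then have "computable (\<lambda>p. f (fst p) (fst (snd p)) (snd (snd p)))"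
    by (rule computableI) simp
  then show ?thesis using assms(2-4) by (rule computable_comp3)
qed

locale perfect_computable_space =
  fixes q :: "nat \<Rightarrow> 'a::metric_space" and approx :: "nat \<Rightarrow> nat \<Rightarrow> nat \<Rightarrow> nat"
    and origin :: "nat \<times> nat"
  assumes complete: "complete (UNIV :: 'a set)"
    and dense: "closure (range q) = UNIV"
    and approx_computable: "computable_fun3 approx"
    and approx: "\<And>i k n. case prod_decode (approx i k n) of (a, b) \<Rightarrow>
      \<bar>dist (q i) (q k) - (real a - real b) / 2 ^ n\<bar> \<le> 1 / 2 ^ n"
    and perfect: "\<And>x :: 'a. x islimpt UNIV"
    and origin_pos: "snd origin > 0"
begin

text \<open>A node \<open>(c, k)\<close> stands for the ball around \<open>q c\<close> of radius \<open>2 / 2\<^sup>k\<close>. Its sons have centres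
  \<open>c\<close> and some \<open>c'\<close> with \<open>1 / 2\<^sup>m \<le> dist (q c) (q c') \<le> 1 / 2\<^sup>k\<close>, where \<open>(c', m)\<close> is found by search.\<close>

definition split_ok :: "nat \<times> nat \<Rightarrow> nat \<Rightarrow> bool" where
  "split_ok p n \<longleftrightarrow> (case prod_decode n of (c', m) \<Rightarrow>
     case prod_decode (approx (fst p) c' (m + 2)) of (a, b) \<Rightarrow>
       snd p \<le> m \<and> b + 5 \<le> a \<and> a + 1 \<le> b + 2 ^ (m + 2 - snd p))"

definition target :: "nat \<times> nat \<Rightarrow> nat" where
  "target p = fst (prod_decode (LEAST n. split_ok p n))"

definition gap :: "nat \<times> nat \<Rightarrow> nat" where
  "gap p = snd (prod_decode (LEAST n. split_ok p n))"

text \<open>At exponent \<open>gap p + 4\<close> the radius is one eighth of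
  \<open>1 / 2 ^ gap p\<close>, the guaranteed distance between the two centres.\<close>

definition son :: "bool \<Rightarrow> nat \<times> nat \<Rightarrow> nat \<times> nat" where
  "son b p = (if b then target p else fst p, gap p + 4)"

lemma approx_bounds:
  assumes "prod_decode (approx i k n) = (a, b)"
  shows "(real a - real b - 1) / 2 ^ n \<le> dist (q i) (q k)"
    "dist (q i) (q k) \<le> (real a - real b + 1) / 2 ^ n"
  using approx[of i k n] assms by (auto simp: abs_le_iff diff_divide_distrib add_divide_distrib)

text \<open>Perfectness gives a second point near the centre, density a special one, and sufficient
  precision lets the approximation confirm both strict bounds.\<close>

lemma ex_split_ok: "\<exists>n. split_ok p n"
proof -
  obtain c k where p: "p = (c, k)" by fastforce
  obtain y where y: "y \<noteq> q c" "dist y (q c) < 1 / 2 ^ Suc k"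
    using perfect[of "q c"] unfolding islimpt_approachable by (metis zero_less_divide_1_iff zero_less_numeral zero_less_power)
  \<comment> \<open>The first term keeps \<open>q c'\<close> away from \<open>q c\<close>, the
    second keeps it within \<open>1 / 2 ^ Suc k\<close>; half of the permitted distance is left to
    absorb the approximation error.\<close>
  define \<epsilon> where "\<epsilon> = min (dist y (q c)) (1 / 2 ^ Suc k - dist y (q c))"
  have "\<epsilon> > 0" using y by (simp add: \<epsilon>_def)
  moreover have "y \<in> closure (range q)" using dense by simp
  ultimately obtain c' where c': "dist (q c') y < \<epsilon>" unfolding closure_approachable by blast
  define d where "d = dist (q c) (q c')"
  have "d > 0"
  proof -
    have "q c' \<noteq> q c" using c' by (auto simp: \<epsilon>_def dist_commute)
    then show ?thesis by (simp add: d_def)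
  qed
  have "d < 1 / 2 ^ Suc k"
    using c' dist_triangle[of "q c" "q c'" y] by (simp add: d_def \<epsilon>_def dist_commute)
  \<comment> \<open>The 6 is the 5 demanded by \<open>split_ok\<close> plus one unit of
    approximation error.\<close>
  obtain m0 where m0: "6 / d < 2 ^ m0" using real_arch_pow[of 2 "6 / d"] by auto
  define m where "m = m0 + k"
  have "6 < d * 2 ^ m0" using m0 \<open>d > 0\<close> by (simp add: field_simps)
  also have "\<dots> \<le> d * 2 ^ (m + 2)"
    using \<open>d > 0\<close> unfolding m_def by (intro mult_left_mono power_increasing) auto
  finally have lower: "6 < d * 2 ^ (m + 2)" .
  have "d * 2 ^ (m + 2) < 1 / 2 ^ Suc k * 2 ^ (m + 2)"
    using \<open>d < _\<close> by (intro mult_strict_right_mono) auto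
  also have "\<dots> = 2 * 2 ^ m0"
    by (simp add: m_def power_add)
  finally have upper: "d * 2 ^ (m + 2) < 2 * 2 ^ m0" .
  obtain a b where ab: "prod_decode (approx c c' (m + 2)) = (a, b)" by fastforce
  have "real a - real b - 1 \<le> d * 2 ^ (m + 2)" "d * 2 ^ (m + 2) \<le> real a - real b + 1"
    using approx_bounds[OF ab] unfolding d_def[symmetric] by (simp_all add: field_simps)
  then have "real b + 5 < real a" "real a < real b + 1 + 2 * 2 ^ m0" using lower upper by linarith+
  moreover have "(3 :: real) \<le> 2 * 2 ^ m0"
    using lower upper by linarith
  ultimately have "real (b + 5) < real a" "real (a + 1) \<le> real (b + 2 ^ (m + 2 - k))"
    by (simp_all add: m_def power_add)
  then have "b + 5 \<le> a" "a + 1 \<le> b + 2 ^ (m + 2 - k)"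
    by (simp_all only: of_nat_le_iff of_nat_less_iff)
  then have "split_ok p (prod_encode (c', m))"
    using ab unfolding split_ok_def p by (simp add: m_def)
  then show ?thesis by blast
qed

lemma split_bounds:
  shows "snd p \<le> gap p"
    and "1 / 2 ^ gap p \<le> dist (q (fst p)) (q (target p))"
    and "dist (q (fst p)) (q (target p)) \<le> 1 / 2 ^ snd p"
proof -
  obtain a b where ab: "prod_decode (approx (fst p) (target p) (gap p + 2)) = (a, b)" by fastforce
  have "split_ok p (LEAST n. split_ok p n)" using ex_split_ok by (rule LeastI_ex)
  then have *: "snd p \<le> gap p" "b + 5 \<le> a" "a + 1 \<le> b + 2 ^ (gap p + 2 - snd p)"
    using ab unfolding split_ok_def target_def gap_def by (auto simp: case_prod_beta)
  show "snd p \<le> gap p" by fact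
  \<comment> \<open>At precision \<open>gap p + 2\<close> the value \<open>1 / 2 ^ gap p\<close> is
    4 units: the test demands 5, and the error takes one.\<close>
  have "(4 :: real) \<le> real a - real b - 1" using *(2) by simp
  then have "4 / 2 ^ (gap p + 2) \<le> (real a - real b - 1) / 2 ^ (gap p + 2)"
    by (rule divide_right_mono) simp
  also note approx_bounds(1)[OF ab]
  finally show "1 / 2 ^ gap p \<le> dist (q (fst p)) (q (target p))" by (simp add: power_add)
  note approx_bounds(2)[OF ab]
  also have "real (a + 1) \<le> real (b + 2 ^ (gap p + 2 - snd p))"
    using *(3) by (simp only: of_nat_le_iff)
  then have "(real a - real b + 1) / 2 ^ (gap p + 2) \<le> 2 ^ (gap p + 2 - snd p) / 2 ^ (gap p + 2)"
    by (intro divide_right_mono) simp_all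
  also have "(2 :: real) ^ (gap p + 2 - snd p) / 2 ^ (gap p + 2) = 1 / 2 ^ snd p"
    using *(1) by (simp add: power_diff)
  finally show "dist (q (fst p)) (q (target p)) \<le> 1 / 2 ^ snd p" .
qed

lemma computable_split_ok: "computable (\<lambda>p. split_ok (fst p) (snd p))"
  unfolding split_ok_def case_prod_beta
  by (intro computable_intros computable_fun3_comp[OF approx_computable])

lemma computable_target [computable_intros]: "computable f \<Longrightarrow> computable (\<lambda>x. target (f x))"
  by (rule computable_comp[of target])
     (unfold target_def, intro computable_intros computable_Least computable_split_ok ex_split_ok)

lemma computable_gap [computable_intros]: "computable f \<Longrightarrow> computable (\<lambda>x. gap (f x))"
  by (rule computable_comp[of gap])
     (unfold gap_def, intro computable_intros computable_Least computable_split_ok ex_split_ok)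

lemma computable_son [computable_intros]:
  "computable f \<Longrightarrow> computable g \<Longrightarrow> computable (\<lambda>x. son (f x) (g x))"
  unfolding son_def by (intro computable_intros)

definition node :: "bool list \<Rightarrow> nat \<times> nat" where
  "node bs = fold son bs origin"

text \<open>Entry \<open>i\<close> depends on the first \<open>i\<close> bits only, so
  \<open>n\<close> bits determine \<open>n\<close> entries, the equal lengths that
  \<open>restr_eq\<close> asks for.\<close>

definition path :: "bool list \<Rightarrow> nat list" where
  "path bs = map (\<lambda>i. fst (node (take i bs))) [0..<length bs]"

lemma computable_node [computable_intros]: "computable f \<Longrightarrow> computable (\<lambda>x. node (f x))"
  unfolding node_def by (intro computable_intros)

lemma computable_path: "computable path"
  unfolding path_def by (intro computable_intros)

section \<open>The branch of a set, its limit, and recovery of the set\<close>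

context
  fixes A :: "nat \<Rightarrow> bool"
begin

definition branch :: "nat \<Rightarrow> nat \<times> nat" where
  "branch n = node (map A [0..<n])"

definition centre :: "nat \<Rightarrow> nat" where
  "centre n = fst (branch n)"

lemma branch_0: "branch 0 = origin"
  and branch_Suc: "branch (Suc n) = son (A n) (branch n)"
  by (simp_all add: branch_def node_def)

lemma restr_centre: "restr centre n = path (map A [0..<n])"
  by (simp add: restr_def path_def centre_def branch_def take_map min_def)

lemma radius_Suc: "snd (branch n) + 4 \<le> snd (branch (Suc n))"
  using split_bounds(1)[of "branch n"] by (simp add: branch_Suc son_def)

lemma radius_ge: "snd origin + n \<le> snd (branch n)"
proof (induction n)
  case (Suc n)
  then show ?case using radius_Suc[of n] by simp
qed (simp add: branch_0)

lemma dist_centre_Suc: "dist (q (centre n)) (q (centre (Suc n))) \<le> 1 / 2 ^ snd (branch n)"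
  using split_bounds(3)[of "branch n"] by (simp add: centre_def branch_Suc son_def)

text \<open>One step costs at most \<open>1 / 2 ^ k\<close>; by induction from the next node the
  rest costs at most \<open>2 / 2 ^ (k + 4)\<close>, which is smaller.\<close>

lemma dist_centre_add: "dist (q (centre n)) (q (centre (n + d))) \<le> 2 / 2 ^ snd (branch n)"
proof (induction d arbitrary: n)
  case (Suc d)
  have "dist (q (centre n)) (q (centre (n + Suc d)))
      \<le> dist (q (centre n)) (q (centre (Suc n))) + dist (q (centre (Suc n))) (q (centre (Suc n + d)))"
    using dist_triangle by simp
  also have "\<dots> \<le> 1 / 2 ^ snd (branch n) + 2 / 2 ^ snd (branch (Suc n))"
    by (intro add_mono dist_centre_Suc Suc.IH)
  also have "2 / 2 ^ snd (branch (Suc n)) \<le> (2 :: real) / 2 ^ (snd (branch n) + 4)"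
    by (intro divide_left_mono power_increasing radius_Suc) auto
  also have "\<dots> \<le> 1 / 2 ^ snd (branch n)" by (simp add: power_add divide_simps)
  finally show ?case by simp
qed simp

lemma dist_centre: "n \<le> m \<Longrightarrow> dist (q (centre n)) (q (centre m)) \<le> 2 / 2 ^ snd (branch n)"
  using dist_centre_add[of n "m - n"] by simp

lemma cauchy_name_centre: "cauchy_name q centre"
  unfolding cauchy_name_def
proof (intro allI impI)
  fix s t :: nat assume "s \<le> t"
  then have "dist (q (centre s)) (q (centre t)) \<le> 2 / 2 ^ snd (branch s)" by (rule dist_centre)
  \<comment> \<open>The positive exponent of the root supplies the halving that cancels the factor 2
    of the radius.\<close>
  also have "\<dots> \<le> 2 / 2 ^ Suc s"
    using radius_ge[of s] origin_pos by (intro divide_left_mono power_increasing) auto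
  finally show "dist (q (centre s)) (q (centre t)) \<le> 1 / 2 ^ s" by simp
qed

lemma names_dist_le:
  assumes "(\<lambda>s. q (\<beta> s)) \<longlonglongrightarrow> x" "\<And>t. s \<le> t \<Longrightarrow> dist (q (\<beta> s)) (q (\<beta> t)) \<le> r"
  shows "dist (q (\<beta> s)) x \<le> r"
proof (rule Lim_bounded)
  show "(\<lambda>t. dist (q (\<beta> s)) (q (\<beta> t))) \<longlonglongrightarrow> dist (q (\<beta> s)) x"
    by (intro tendsto_intros assms(1))
qed (use assms(2) in blast)

lemma ex_limit: "\<exists>x. names q centre x"
proof -
  have "Cauchy (\<lambda>s. q (centre s))"
  proof (rule metric_CauchyI)
    fix e :: real assume "0 < e"
    then obtain s where s: "(1 / 2) ^ s < e" using real_arch_pow_inv[of e "1 / 2"] by auto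
    have "dist (q (centre m)) (q (centre n)) < e" if "s + 1 \<le> m" "s + 1 \<le> n" for m n
    proof -
      have "dist (q (centre (s + 1))) (q (centre m)) \<le> 1 / 2 ^ (s + 1)"
        "dist (q (centre (s + 1))) (q (centre n)) \<le> 1 / 2 ^ (s + 1)"
        using that cauchy_name_centre unfolding cauchy_name_def by blast+
      then have "dist (q (centre m)) (q (centre n)) \<le> 1 / 2 ^ (s + 1) + 1 / 2 ^ (s + 1)"
        using dist_triangle2[of "q (centre m)" "q (centre n)" "q (centre (s + 1))"]
        by (simp add: dist_commute)
      also have "\<dots> = (1 / 2) ^ s" by (simp add: power_one_over)
      finally show ?thesis using s by simp
    qed
    then show "\<exists>M. \<forall>m\<ge>M. \<forall>n\<ge>M. dist (q (centre m)) (q (centre n)) < e" by blast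
  qed
  then obtain x where "(\<lambda>s. q (centre s)) \<longlonglongrightarrow> x"
    using complete unfolding complete_def by blast
  then show ?thesis unfolding names_def using cauchy_name_centre by blast
qed

lemma dist_limit: "names q centre x \<Longrightarrow> dist (q (centre n)) x \<le> 2 / 2 ^ snd (branch n)"
  unfolding names_def by (rule names_dist_le[of centre]) (auto intro: dist_centre)

text \<open>The limit lies within \<open>1 / 8\<close> of the distance of the two sons from one of them, so an
  approximation to the limit tells which.\<close>

definition turn :: "(nat \<Rightarrow> nat) \<Rightarrow> nat \<times> nat \<Rightarrow> bool" where
  "turn \<beta> p \<longleftrightarrow> (case prod_decode (approx (\<beta> (gap p + 3)) (fst p) (gap p + 3)) of (a, b) \<Rightarrow> b + 4 \<le> a)"

lemma turn_branch:
  assumes x: "names q centre x" and \<beta>: "names q \<beta> x"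
  shows "turn \<beta> (branch n) \<longleftrightarrow> A n"
proof -
  define p where "p = branch n"
  \<comment> \<open>In the unit \<open>u\<close> the centres are at least 8 apart, while the ball,
    the name and the approximation each err by at most 1. Hence \<open>d\<close> is at least 6 or at
    most 2 units, so \<open>a - b\<close> is at least 5 or at most 3, and the threshold 4 separates
    the cases.\<close>
  define u :: real where "u = 1 / 2 ^ (gap p + 3)"
  have u: "u > 0" "1 / 2 ^ gap p = 8 * u" "2 / 2 ^ (gap p + 4) = u"
    by (simp_all add: u_def power_add)
  obtain a b where ab: "prod_decode (approx (\<beta> (gap p + 3)) (fst p) (gap p + 3)) = (a, b)" by fastforce
  define d where "d = dist (q (\<beta> (gap p + 3))) (q (fst p))"
  have ab_u: "(real a - real b - 1) * u \<le> d" "d \<le> (real a - real b + 1) * u"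
    using approx_bounds[OF ab] by (simp_all add: d_def u_def)
  have "dist (q (\<beta> s)) x \<le> 1 / 2 ^ s" for s
  proof (rule names_dist_le[of \<beta>])
    show "(\<lambda>s. q (\<beta> s)) \<longlonglongrightarrow> x" using \<beta> by (simp add: names_def)
    show "dist (q (\<beta> s)) (q (\<beta> t)) \<le> 1 / 2 ^ s" if "s \<le> t" for t
      using \<beta> that unfolding names_def cauchy_name_def by blast
  qed
  then have b: "dist (q (\<beta> (gap p + 3))) x \<le> u" unfolding u_def .
  have "snd (branch (Suc n)) = gap p + 4" by (simp add: branch_Suc son_def p_def)
  then have c: "dist (q (centre (Suc n))) x \<le> u"
    using dist_limit[OF x, of "Suc n"] u(3) by simp
  have turn: "turn \<beta> p \<longleftrightarrow> b + 4 \<le> a" by (simp add: turn_def ab)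
  show ?thesis
  proof (cases "A n")
    case True
    then have "dist (q (target p)) x \<le> u" using c by (simp add: centre_def branch_Suc son_def p_def)
    moreover have "8 * u \<le> dist (q (fst p)) (q (target p))" using split_bounds(2)[of p] u(2) by simp
    moreover have "dist (q (fst p)) (q (target p)) \<le> d + dist (q (\<beta> (gap p + 3))) x + dist (q (target p)) x"
      using dist_triangle[of "q (fst p)" "q (target p)" "q (\<beta> (gap p + 3))"]
        dist_triangle2[of "q (\<beta> (gap p + 3))" "q (target p)" x]
      by (simp add: d_def dist_commute)
    ultimately have "6 * u \<le> (real a - real b + 1) * u" using b ab_u(2) by linarith
    then have "6 \<le> real a - real b + 1" using u(1) by simp
    then show ?thesis using True turn p_def by simp
  next
    case False
    then have "dist (q (fst p)) x \<le> u" using c by (simp add: centre_def branch_Suc son_def p_def)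
    then have "d \<le> 2 * u"
      using b dist_triangle2[of "q (\<beta> (gap p + 3))" "q (fst p)" x] by (simp add: d_def)
    then have "(real a - real b - 1) * u \<le> 2 * u" using ab_u(1) by linarith
    then have "real a - real b - 1 \<le> 2" using u(1) by simp
    then show ?thesis using False turn p_def by simp
  qed
qed

text \<open>The node at \<open>n\<close> is needed to decide turn \<open>n\<close>, and that turn to
  find the next node; a single recursion that consults only the name \<open>\<beta>\<close> yields
  both.\<close>

lemma computable_from_limit:
  assumes "names q centre x" "computable_point q x"
  shows "computable A"
proof -
  obtain \<beta> where \<beta>: "computable_fun \<beta>" "names q \<beta> x"
    using assms(2) unfolding computable_point_def by blast
  note [computable_intros] = \<beta>(1)[folded computable_nat_iff, THEN computable_comp]
  have "computable (turn \<beta>)"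
    unfolding turn_def case_prod_beta
    by (intro computable_intros computable_fun3_comp[OF approx_computable])
  note [computable_intros] = this[THEN computable_comp]
  have "computable (\<lambda>n. turn \<beta> (rec_nat origin (\<lambda>_ p. son (turn \<beta> p) p) n))"
    by (intro computable_intros)
  moreover have "rec_nat origin (\<lambda>_ p. son (turn \<beta> p) p) n = branch n" for n
    by (induction n) (simp_all add: branch_0 branch_Suc turn_branch[OF assms(1) \<beta>(2)])
  ultimately show ?thesis by (simp add: turn_branch[OF assms(1) \<beta>(2)])
qed

end

end

theorem mainTheorem16:
  fixes q :: "nat \<Rightarrow> 'a::metric_space"
  assumes "computable_metric_space q"
    and "\<forall>x::'a. x islimpt (UNIV :: 'a set)"
  shows "\<forall>j (\<delta>::rat). \<delta> > 0 \<longrightarrow>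
           (\<exists>x. \<not> computable_point q x \<and> K_trivial_point q x \<and> dist (q j) x < real_of_rat \<delta>)"
proof (intro allI impI)
  fix j :: nat and \<delta> :: rat
  assume "\<delta> > 0"
  then obtain k where k: "(1 / 2) ^ k < real_of_rat \<delta>"
    using real_arch_pow_inv[of "real_of_rat \<delta>" "1 / 2"] by auto
  obtain approx where "computable_fun3 approx" "\<forall>i k n. case prod_decode (approx i k n) of (a, b) \<Rightarrow>
      \<bar>dist (q i) (q k) - (real a - real b) / 2 ^ n\<bar> \<le> 1 / 2 ^ n"
    using assms(1) unfolding computable_metric_space_def by blast
  \<comment> \<open>With exponent \<open>Suc k\<close> the root ball has radius (1/2)^k, below the
    prescribed bound, and the exponent is positive as required.\<close>
  then interpret P: perfect_computable_space q approx "(j, Suc k)"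
    using assms by unfold_locales (simp_all add: computable_metric_space_def)
  interpret L: low_set_functional P.path "P.centre low_set"
    by unfold_locales (rule P.computable_path P.restr_centre)+
  obtain x where x: "names q (P.centre low_set) x" using P.ex_limit by blast
  have "\<not> computable_point q x"
    using P.computable_from_limit[OF x] low_set_not_computable by blast
  moreover have "K_trivial_point q x"
    using L.K_trivial x unfolding K_trivial_point_def by blast
  moreover have "dist (q j) x < real_of_rat \<delta>"
  proof -
    have "dist (q j) x \<le> (1 / 2) ^ k"
      using P.dist_limit[OF x, of 0] by (simp add: P.centre_def P.branch_0 power_one_over)
    then show ?thesis using k by simp
  qed
  ultimately show "\<exists>x. \<not> computable_point q x \<and> K_trivial_point q x \<and> dist (q j) x < real_of_rat \<delta>"
    by blast
qed

end
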